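(* Let $(A,* )$ and $(V,h)$ satisfy the standing assumptions in the context (in particular $A$ is finite), where $V$ has rank $m>2$, and let $U$ be the unitary group of $(V,h)$. Let $u\in V$ be a primitive vector of non-unit length $h(u,u)$, and let $S_u$ be the stabilizer of $u$ in $U$. Let $U'$ be the unitary group associated to a hermitian form of the same kind as $h$ defined on a free $A$-module of rank $m-2$. Then $$|S_u|=|U'|\times|A|^{m-1}/|R|.$$
   Context: Standing assumptions. $A$ is a finite ring with identity, not necessarily commutative, with Jacobson radical $\mathfrak{r}$, which is local in the sense that $A/\mathfrak{r}$ is a division ring. $*$ is an involution of $A$, i.e. an anti-automorphism of order $\le 2$. The elements fixed by $*$ lie in the center of $A$; they form a local ring $R$ with Jacobson radical $\mathfrak{m}=R\cap\mathfrak{r}$. The residue field $R/\mathfrak{m}=F_q$ is a finite field of odd characteristic, and the squaring map of $1+\mathfrak{m}$ is surjective. $V$ is a free right $A$-module of rank $m$ and $h:V\times V\to A$ is a non-degenerate $*$-hermitian form: $h$ is biadditive, $h(u,va)=h(u,v)a$, $h(v,u)=h(u,v)^*$, and $u\mapsto h(u,-)$ is an isomorphism from $V$ onto $V^*=\mathrm{Hom}_A(V,A)$, a right $A$-module via $(\alpha a)(v)=a^*\alpha(v)$. The unitary group of $(V,h)$ is the group of all $A$-linear automorphisms of $V$ preserving $h$. The length of $v$ is $h(v,v)\in R$. A vector $v\in V$ is primitive if $v\notin V\mathfrak{r}$, equivalently if $v$ belongs to a basis of $V$. Kinds of forms. Fix $\epsilon\in R^*\setminus R^{*2}$, where $R^{*2}$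 is the group of squares of units of $R$ (it has index $2$ in $R^*$). A non-degenerate hermitian form on a free module of rank $m$ is of type $\{r_1,\dots,r_m\}$, $r_i\in R^*$, if it has matrix $\mathrm{diag}(r_1,\dots,r_m)$ relative to some basis. If $m$ is even, it is of kind I if it is of type $\{1,-1,\dots,1,-1\}$ and of kind II if it is of type $\{1,-1,\dots,1,-\epsilon\}$. If $m$ is odd, it is of kind I if it is of type $\{1,-1,\dots,1,-1,-1\}$ and of kind II if it is of type $\{1,-1,\dots,1,-1,-\epsilon\}$. (Every non-degenerate form is of kind I or II; it is of both kinds if and only if the norm map $A^*\to R^*$, $a\mapsto aa^*$, is surjective.) *)

theory Defs
  imports Complex_Main "HOL-Algebra.Algebra"
begin

section \<open>Local rings with involution\<close>

definition division_ring :: "('a, 'r) ring_scheme \<Rightarrow> bool" where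
  "division_ring D \<longleftrightarrow> ring D \<and> \<one>\<^bsub>D\<^esub> \<noteq> \<zero>\<^bsub>D\<^esub> \<and> Units D = carrier D - {\<zero>\<^bsub>D\<^esub>}"

definition right_ideal :: "'a set \<Rightarrow> ('a, 'r) ring_scheme \<Rightarrow> bool" where
  "right_ideal I A \<longleftrightarrow> subgroup I (add_monoid A) \<and> (\<forall>x\<in>I. \<forall>a\<in>carrier A. x \<otimes>\<^bsub>A\<^esub> a \<in> I)"

definition maximal_right_ideal :: "'a set \<Rightarrow> ('a, 'r) ring_scheme \<Rightarrow> bool" where
  "maximal_right_ideal I A \<longleftrightarrow> right_ideal I A \<and> I \<noteq> carrier A \<and>
     (\<forall>J. right_ideal J A \<and> I \<subseteq> J \<longrightarrow> J = I \<or> J = carrier A)"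

definition jacobson_radical :: "('a, 'r) ring_scheme \<Rightarrow> 'a set" where
  "jacobson_radical A = carrier A \<inter> \<Inter> {I. maximal_right_ideal I A}"

definition local_ring :: "('a, 'r) ring_scheme \<Rightarrow> bool" where
  "local_ring A \<longleftrightarrow> ring A \<and> division_ring (A Quot (jacobson_radical A))"

definition ring_characteristic :: "('a, 'r) ring_scheme \<Rightarrow> nat" where
  "ring_characteristic K = group.ord (add_monoid K) \<one>\<^bsub>K\<^esub>"

definition opposite_ring :: "('a, 'r) ring_scheme \<Rightarrow> ('a, 'r) ring_scheme" where
  "opposite_ring A = A\<lparr>monoid.mult := \<lambda>x y. y \<otimes>\<^bsub>A\<^esub> x\<rparr>"

definition ring_involution :: "('a, 'r) ring_scheme \<Rightarrow> ('a \<Rightarrow> 'a) \<Rightarrow> bool" where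
  "ring_involution A star \<longleftrightarrow>
     star \<in> ring_iso A (opposite_ring A) \<and> (\<forall>a\<in>carrier A. star (star a) = a)"

definition fixed_ring :: "('a, 'r) ring_scheme \<Rightarrow> ('a \<Rightarrow> 'a) \<Rightarrow> ('a, 'r) ring_scheme" where
  "fixed_ring A star = A\<lparr>carrier := {a \<in> carrier A. star a = a}\<rparr>"

definition fixed_radical :: "('a, 'r) ring_scheme \<Rightarrow> ('a \<Rightarrow> 'a) \<Rightarrow> 'a set" where
  "fixed_radical A star = carrier (fixed_ring A star) \<inter> jacobson_radical A"

locale finite_local_involution_ring =
  fixes A :: "('a, 'r) ring_scheme" and star :: "'a \<Rightarrow> 'a"
  assumes finite_carrier: "finite (carrier A)"
    and local: "local_ring A"
    and involution: "ring_involution A star"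
    and fixed_central: "\<forall>r\<in>carrier (fixed_ring A star). \<forall>a\<in>carrier A. r \<otimes>\<^bsub>A\<^esub> a = a \<otimes>\<^bsub>A\<^esub> r"
    and fixed_local: "local_ring (fixed_ring A star)"
    and fixed_jacobson: "jacobson_radical (fixed_ring A star) = fixed_radical A star"
    and residue_field: "field (fixed_ring A star Quot fixed_radical A star)"
    and odd_characteristic:
      "odd (ring_characteristic (fixed_ring A star Quot fixed_radical A star))"
    and squaring_surjective:
      "(\<lambda>x. x \<otimes>\<^bsub>A\<^esub> x) ` (\<one>\<^bsub>A\<^esub> <+\<^bsub>A\<^esub> fixed_radical A star)
         = \<one>\<^bsub>A\<^esub> <+\<^bsub>A\<^esub> fixed_radical A star"

definition unit_squares :: "('a, 'r) ring_scheme \<Rightarrow> 'a set" where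
  "unit_squares R = {x \<otimes>\<^bsub>R\<^esub> x | x. x \<in> Units R}"

section \<open>Right modules\<close>

text \<open>
  Right modules are carried by the library's module record, whose
  \<open>smult\<close> takes the scalar first: \<open>a \<odot>\<^bsub>V\<^esub> v\<close> stands for \<open>va\<close>.  The ring
  multiplication and unit contained in that record play no role for modules.
\<close>

locale right_module =
  fixes A :: "('a, 'r) ring_scheme" and V :: "('a, 'v, 's) module_scheme"
  assumes scalar_ring: "ring A"
    and vector_group: "abelian_group V"
    and smult_closed: "\<lbrakk>a \<in> carrier A; v \<in> carrier V\<rbrakk> \<Longrightarrow> a \<odot>\<^bsub>V\<^esub> v \<in> carrier V"
    and smult_l_distr: "\<lbrakk>a \<in> carrier A; b \<in> carrier A; v \<in> carrier V\<rbrakk> \<Longrightarrow>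
      (a \<oplus>\<^bsub>A\<^esub> b) \<odot>\<^bsub>V\<^esub> v = a \<odot>\<^bsub>V\<^esub> v \<oplus>\<^bsub>V\<^esub> b \<odot>\<^bsub>V\<^esub> v"
    and smult_r_distr: "\<lbrakk>a \<in> carrier A; v \<in> carrier V; w \<in> carrier V\<rbrakk> \<Longrightarrow>
      a \<odot>\<^bsub>V\<^esub> (v \<oplus>\<^bsub>V\<^esub> w) = a \<odot>\<^bsub>V\<^esub> v \<oplus>\<^bsub>V\<^esub> a \<odot>\<^bsub>V\<^esub> w"
    and smult_assoc: "\<lbrakk>a \<in> carrier A; b \<in> carrier A; v \<in> carrier V\<rbrakk> \<Longrightarrow>
      (a \<otimes>\<^bsub>A\<^esub> b) \<odot>\<^bsub>V\<^esub> v = b \<odot>\<^bsub>V\<^esub> (a \<odot>\<^bsub>V\<^esub> v)"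
    and smult_one: "v \<in> carrier V \<Longrightarrow> \<one>\<^bsub>A\<^esub> \<odot>\<^bsub>V\<^esub> v = v"

definition right_module_hom ::
  "('a, 'r) ring_scheme \<Rightarrow> ('a, 'v, 's) module_scheme \<Rightarrow> ('a, 'w, 't) module_scheme \<Rightarrow> ('v \<Rightarrow> 'w) set"
  where
  "right_module_hom A V W = {f. f \<in> carrier V \<rightarrow> carrier W \<and>
     (\<forall>v\<in>carrier V. \<forall>w\<in>carrier V. f (v \<oplus>\<^bsub>V\<^esub> w) = f v \<oplus>\<^bsub>W\<^esub> f w) \<and>
     (\<forall>a\<in>carrier A. \<forall>v\<in>carrier V. f (a \<odot>\<^bsub>V\<^esub> v) = a \<odot>\<^bsub>W\<^esub> f v)}"

definition right_module_iso ::
  "('a, 'r) ring_scheme \<Rightarrow> ('a, 'v, 's) module_scheme \<Rightarrow> ('a, 'w, 't) module_scheme \<Rightarrow> ('v \<Rightarrow> 'w) set"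
  where
  "right_module_iso A V W = {f \<in> right_module_hom A V W. bij_betw f (carrier V) (carrier W)}"

definition regular_module :: "('a, 'r) ring_scheme \<Rightarrow> ('a, 'a) module" where
  "regular_module A = \<lparr>carrier = carrier A, monoid.mult = monoid.mult A, monoid.one = monoid.one A, ring.zero = ring.zero A,
     ring.add = ring.add A, smult = \<lambda>a x. x \<otimes>\<^bsub>A\<^esub> a\<rparr>"

definition is_basis ::
  "('a, 'r) ring_scheme \<Rightarrow> ('a, 'v, 's) module_scheme \<Rightarrow> nat \<Rightarrow> (nat \<Rightarrow> 'v) \<Rightarrow> bool" where
  "is_basis A V m b \<longleftrightarrow> (\<forall>i<m. b i \<in> carrier V) \<and>
     (\<forall>v\<in>carrier V. \<exists>!c. c \<in> {..<m} \<rightarrow>\<^sub>E carrier A \<and> v = (\<Oplus>\<^bsub>V\<^esub>i\<in>{..<m}. c i \<odot>\<^bsub>V\<^esub> b i))"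

definition free_of_rank ::
  "('a, 'r) ring_scheme \<Rightarrow> ('a, 'v, 's) module_scheme \<Rightarrow> nat \<Rightarrow> bool" where
  "free_of_rank A V m \<longleftrightarrow> right_module A V \<and> (\<exists>b. is_basis A V m b)"

text \<open>\<open>module_mult_set V J\<close> is \<open>VJ\<close>, the set of finite sums of vectors \<open>va\<close> with \<open>a \<in> J\<close>.\<close>

definition module_mult_set ::
  "('a, 'v, 's) module_scheme \<Rightarrow> 'a set \<Rightarrow> 'v set" where
  "module_mult_set V J = generate (add_monoid V) {a \<odot>\<^bsub>V\<^esub> v | a v. a \<in> J \<and> v \<in> carrier V}"

definition primitive_vector ::
  "('a, 'r) ring_scheme \<Rightarrow> ('a, 'v, 's) module_scheme \<Rightarrow> 'v \<Rightarrow> bool" where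
  "primitive_vector A V v \<longleftrightarrow>
     v \<in> carrier V \<and> v \<notin> module_mult_set V (jacobson_radical A)"

section \<open>Hermitian forms and unitary groups\<close>

definition dual_module ::
  "('a, 'r) ring_scheme \<Rightarrow> ('a \<Rightarrow> 'a) \<Rightarrow> ('a, 'v, 's) module_scheme \<Rightarrow> ('a, 'v \<Rightarrow> 'a) module" where
  "dual_module A star V =
     \<lparr>carrier = right_module_hom A V (regular_module A) \<inter> extensional (carrier V),
      monoid.mult = undefined, monoid.one = undefined,
      ring.zero = (\<lambda>v\<in>carrier V. \<zero>\<^bsub>A\<^esub>),
      ring.add = (\<lambda>\<alpha> \<beta>. \<lambda>v\<in>carrier V. \<alpha> v \<oplus>\<^bsub>A\<^esub> \<beta> v),
      smult = (\<lambda>a \<alpha>. \<lambda>v\<in>carrier V. star a \<otimes>\<^bsub>A\<^esub> \<alpha> v)\<rparr>"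

locale hermitian_form =
  fixes A :: "('a, 'r) ring_scheme" and star :: "'a \<Rightarrow> 'a"
    and V :: "('a, 'v, 's) module_scheme" and h :: "'v \<Rightarrow> 'v \<Rightarrow> 'a"
  assumes h_closed: "\<lbrakk>u \<in> carrier V; v \<in> carrier V\<rbrakk> \<Longrightarrow> h u v \<in> carrier A"
    and h_add_left: "\<lbrakk>u \<in> carrier V; v \<in> carrier V; w \<in> carrier V\<rbrakk> \<Longrightarrow>
      h (u \<oplus>\<^bsub>V\<^esub> v) w = h u w \<oplus>\<^bsub>A\<^esub> h v w"
    and h_add_right: "\<lbrakk>u \<in> carrier V; v \<in> carrier V; w \<in> carrier V\<rbrakk> \<Longrightarrow>
      h u (v \<oplus>\<^bsub>V\<^esub> w) = h u v \<oplus>\<^bsub>A\<^esub> h u w"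
    and h_smult_right: "\<lbrakk>u \<in> carrier V; v \<in> carrier V; a \<in> carrier A\<rbrakk> \<Longrightarrow>
      h u (a \<odot>\<^bsub>V\<^esub> v) = h u v \<otimes>\<^bsub>A\<^esub> a"
    and h_star: "\<lbrakk>u \<in> carrier V; v \<in> carrier V\<rbrakk> \<Longrightarrow> h v u = star (h u v)"

definition nondegenerate_hermitian_form ::
  "('a, 'r) ring_scheme \<Rightarrow> ('a \<Rightarrow> 'a) \<Rightarrow> ('a, 'v, 's) module_scheme \<Rightarrow> ('v \<Rightarrow> 'v \<Rightarrow> 'a) \<Rightarrow> bool"
  where
  "nondegenerate_hermitian_form A star V h \<longleftrightarrow> hermitian_form A star V h \<and>
     (\<lambda>u. \<lambda>v\<in>carrier V. h u v) \<in> right_module_iso A V (dual_module A star V)"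

definition form_of_type ::
  "('a, 'r) ring_scheme \<Rightarrow> ('a \<Rightarrow> 'a) \<Rightarrow> nat \<Rightarrow> ('a, 'v, 's) module_scheme \<Rightarrow> ('v \<Rightarrow> 'v \<Rightarrow> 'a)
     \<Rightarrow> (nat \<Rightarrow> 'a) \<Rightarrow> bool"
  where
  "form_of_type A star m V h r \<longleftrightarrow> (\<forall>i<m. r i \<in> Units (fixed_ring A star)) \<and>
     (\<exists>b. is_basis A V m b \<and>
       (\<forall>i<m. \<forall>j<m. h (b i) (b j) = (if i = j then r i else \<zero>\<^bsub>A\<^esub>)))"

text \<open>
  With indices starting at 0, \<open>kind_diagonal A m d\<close> is \<open>1, -1, \<dots>, 1, -d\<close> for even \<open>m\<close> and
  \<open>1, -1, \<dots>, 1, -1, -d\<close> for odd \<open>m\<close>.  Kind I is \<open>d = 1\<close>, kind II is \<open>d = \<epsilon>\<close>.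
\<close>

definition kind_diagonal :: "('a, 'r) ring_scheme \<Rightarrow> nat \<Rightarrow> 'a \<Rightarrow> nat \<Rightarrow> 'a" where
  "kind_diagonal A m d i =
     (if Suc i = m then \<ominus>\<^bsub>A\<^esub> d else if even i then \<one>\<^bsub>A\<^esub> else \<ominus>\<^bsub>A\<^esub> \<one>\<^bsub>A\<^esub>)"

definition kind_I ::
  "('a, 'r) ring_scheme \<Rightarrow> ('a \<Rightarrow> 'a) \<Rightarrow> nat \<Rightarrow> ('a, 'v, 's) module_scheme \<Rightarrow> ('v \<Rightarrow> 'v \<Rightarrow> 'a) \<Rightarrow> bool"
  where
  "kind_I A star m V h \<longleftrightarrow> form_of_type A star m V h (kind_diagonal A m \<one>\<^bsub>A\<^esub>)"

definition kind_II ::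
  "('a, 'r) ring_scheme \<Rightarrow> ('a \<Rightarrow> 'a) \<Rightarrow> 'a \<Rightarrow> nat \<Rightarrow> ('a, 'v, 's) module_scheme \<Rightarrow> ('v \<Rightarrow> 'v \<Rightarrow> 'a)
     \<Rightarrow> bool"
  where
  "kind_II A star \<epsilon> m V h \<longleftrightarrow> form_of_type A star m V h (kind_diagonal A m \<epsilon>)"

definition unitary_group ::
  "('a, 'r) ring_scheme \<Rightarrow> ('a, 'v, 's) module_scheme \<Rightarrow> ('v \<Rightarrow> 'v \<Rightarrow> 'a) \<Rightarrow> ('v \<Rightarrow> 'v) monoid"
  where
  "unitary_group A V h = BijGroup (carrier V)
     \<lparr>carrier := {g \<in> right_module_iso A V V \<inter> extensional (carrier V).
        \<forall>u\<in>carrier V. \<forall>v\<in>carrier V. h (g u) (g v) = h u v}\<rparr>"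

end

theory Submission
  imports Defs
begin

text \<open>
  Write \<open>r = h(u, u)\<close>, an element of the radical of the fixed ring \<open>R\<close>.  Because \<open>u\<close> is
  primitive, it can be completed to a pair \<open>(u, w)\<close> with \<open>h(u, w) = 1\<close> and \<open>h(w, w) = 0\<close>
  (\<open>primitive_vector_pairs_to_one\<close>, \<open>isotropic_partner\<close>), so that \<open>V\<close> is the orthogonal sum of the
  plane spanned by \<open>u, w\<close> and its complement.  An isometry that fixes \<open>u\<close> moves \<open>w\<close> to another such
  partner \<open>x\<close> of \<open>u\<close> and the complement of \<open>u, w\<close> to that of \<open>u, x\<close>.  The partner \<open>x\<close> and
  the isometry between the complements can be prescribed independently, because the Gram matrix of
  \<open>u, x\<close> is the same for all partners.  Thus \<open>|S\<^sub>u|\<close> is the number of partners times \<open>|U'|\<close>, once all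
  complements are known to be isometric to \<open>V'\<close> (\<open>card_stabilizer\<close>).

  That is a case of Witt cancellation.  By the shape of the diagonal matrices of the two kinds,
  \<open>V\<close> has orthogonal vectors of lengths \<open>1\<close> and \<open>-1\<close> whose complement is isometric to \<open>V'\<close>.  The
  plane spanned by \<open>u, x\<close> also contains such a pair, and any two such pairs are conjugate: since
  \<open>2\<close> is a unit and the ring is local, products of reflections act transitively on the vectors of a given unit
  length (\<open>unit_length_transitive\<close>, \<open>hyperbolic_complement\<close>).

  The partners of \<open>u\<close> are counted by coordinates.  They are the vectors \<open>u a + w (1 - r a) + z\<close>
  with \<open>z\<close> in the complement and \<open>a + a\<^sup>* - r a\<^sup>* a = - h(z, z)\<close>.  Split \<open>a\<close> into a fixed part and a
  skew part.  For every \<open>z\<close> and every skew part exactly one fixed part solves the equation, because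
  \<open>x \<mapsto> 2x - r x\<^sup>2\<close> permutes \<open>R\<close> (\<open>fixed_quadratic_bij\<close>).  As \<open>A\<close> is the direct sum of \<open>R\<close> and the
  skew elements, there are \<open>|V'| |A| / |R| = |A|\<^bsup>m-1\<^esup> / |R|\<close> partners.
\<close>

section \<open>Finite local rings\<close>

context ring
begin

lemma right_invertible_imp_Units:
  assumes "finite (carrier R)" "a \<in> carrier R" "b \<in> carrier R" "a \<otimes> b = \<one>"
  shows "a \<in> Units R"
proof -
  have "inj_on (\<lambda>x. b \<otimes> x) (carrier R)"
    by (rule inj_onI) (metis assms(2-4) l_one m_assoc)
  then have "(\<lambda>x. b \<otimes> x) ` carrier R = carrier R"
    using assms by (intro endo_inj_surj) auto
  then obtain c where c: "c \<in> carrier R" "b \<otimes> c = \<one>"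
    by (metis imageE one_closed)
  then have "a = c"
    by (metis assms(2-4) inv_unique)
  with c assms show ?thesis
    unfolding Units_def by auto
qed

lemma jacobson_radical_subgroup: "subgroup (jacobson_radical R) (add_monoid R)"
proof -
  have eq: "jacobson_radical R = \<Inter> (insert (carrier R) {I. maximal_right_ideal I R})"
    unfolding jacobson_radical_def by auto
  have "subgroup (carrier R) (add_monoid R)"
    using group.subgroup_self[OF a_group] by simp
  then show ?thesis unfolding eq
    by (intro group.subgroups_Inter[OF a_group])
       (auto simp: maximal_right_ideal_def right_ideal_def)
qed

lemma jacobson_radical_closed:
  shows "jacobson_radical R \<subseteq> carrier R"
    and "\<zero> \<in> jacobson_radical R"
    and "x \<in> jacobson_radical R \<Longrightarrow> y \<in> jacobson_radical R \<Longrightarrow> x \<oplus> y \<in> jacobson_radical R"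
    and "x \<in> jacobson_radical R \<Longrightarrow> \<ominus> x \<in> jacobson_radical R"
    and "x \<in> jacobson_radical R \<Longrightarrow> a \<in> carrier R \<Longrightarrow> x \<otimes> a \<in> jacobson_radical R"
proof -
  note J = jacobson_radical_subgroup
  show "jacobson_radical R \<subseteq> carrier R"
    by (simp add: jacobson_radical_def)
  show "\<zero> \<in> jacobson_radical R"
    using subgroup.one_closed[OF J] by simp
  show "x \<in> jacobson_radical R \<Longrightarrow> y \<in> jacobson_radical R \<Longrightarrow> x \<oplus> y \<in> jacobson_radical R"
    using subgroup.m_closed[OF J] by simp
  show "x \<in> jacobson_radical R \<Longrightarrow> \<ominus> x \<in> jacobson_radical R"
    using subgroup.m_inv_closed[OF J] by (simp add: a_inv_def)
  show "x \<in> jacobson_radical R \<Longrightarrow> a \<in> carrier R \<Longrightarrow> x \<otimes> a \<in> jacobson_radical R"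
    by (auto simp: jacobson_radical_def maximal_right_ideal_def right_ideal_def)
qed

lemma proper_right_ideal_subset_maximal:
  assumes fin: "finite (carrier R)" and I: "right_ideal I R" "I \<noteq> carrier R"
  shows "\<exists>M. maximal_right_ideal M R \<and> I \<subseteq> M"
proof -
  define \<I> where "\<I> = {J. right_ideal J R \<and> J \<noteq> carrier R \<and> I \<subseteq> J}"
  have sub: "J \<subseteq> carrier R" if "right_ideal J R" for J
    using that subgroup.subset by (fastforce simp: right_ideal_def)
  then have "finite \<I>"
    using fin by (intro finite_subset[of \<I> "Pow (carrier R)"]) (auto simp: \<I>_def)
  moreover have "I \<in> \<I>" using I by (simp add: \<I>_def)
  ultimately obtain M where M: "M \<in> \<I>" "I \<subseteq> M" "\<And>J. J \<in> \<I> \<Longrightarrow> M \<subseteq> J \<Longrightarrow> M = J"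
    using finite_has_maximal2 by (metis (no_types, lifting))
  then show ?thesis
    unfolding maximal_right_ideal_def by (intro exI[of _ M]) (auto simp: \<I>_def)
qed

lemma principal_right_ideal:
  assumes "a \<in> carrier R"
  shows "right_ideal ((\<lambda>x. a \<otimes> x) ` carrier R) R"
  unfolding right_ideal_def
proof (intro conjI ballI group.subgroupI[OF a_group])
  fix x y assume "x \<in> (\<lambda>x. a \<otimes> x) ` carrier R"
  then obtain x' where x: "x = a \<otimes> x'" "x' \<in> carrier R" by auto
  show "inv\<^bsub>add_monoid R\<^esub> x \<in> (\<lambda>x. a \<otimes> x) ` carrier R"
    using assms x by (auto simp: a_inv_def[symmetric] image_iff r_minus intro!: bexI[of _ "\<ominus> x'"])
  show "x \<otimes>\<^bsub>add_monoid R\<^esub> y \<in> (\<lambda>x. a \<otimes> x) ` carrier R"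
    if "y \<in> (\<lambda>x. a \<otimes> x) ` carrier R"
  proof -
    from that obtain y' where "y = a \<otimes> y'" "y' \<in> carrier R" by auto
    then show ?thesis
      using assms x by (auto simp: image_iff r_distr intro!: bexI[of _ "x' \<oplus> y'"])
  qed
  show "x \<otimes> y \<in> (\<lambda>x. a \<otimes> x) ` carrier R" if "y \<in> carrier R"
    using that assms x by (auto simp: image_iff m_assoc intro!: bexI[of _ "x' \<otimes> y"])
qed (use assms in auto)

text \<open>A maximal right ideal above \<open>(1 + j)A\<close> would contain \<open>j\<close>, hence \<open>1\<close>; so \<open>1 + j\<close> has a right
  inverse.  Finiteness turns it into a two-sided one and also provides the maximal right
  ideal.\<close>

lemma one_plus_jacobson_radical_Units:
  assumes fin: "finite (carrier R)" and j: "j \<in> jacobson_radical R"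
  shows "\<one> \<oplus> j \<in> Units R"
proof (rule ccontr)
  have jc: "j \<in> carrier R" using j jacobson_radical_closed(1) by auto
  let ?I = "(\<lambda>x. (\<one> \<oplus> j) \<otimes> x) ` carrier R"
  assume nu: "\<one> \<oplus> j \<notin> Units R"
  have "\<one> \<notin> ?I"
  proof
    assume "\<one> \<in> ?I"
    then obtain x where "x \<in> carrier R" "(\<one> \<oplus> j) \<otimes> x = \<one>" by force
    with nu right_invertible_imp_Units[OF fin, of "\<one> \<oplus> j" x] jc show False by auto
  qed
  then have "?I \<noteq> carrier R" by (metis one_closed)
  then obtain M where M: "maximal_right_ideal M R" "?I \<subseteq> M"
    using proper_right_ideal_subset_maximal[OF fin principal_right_ideal] jc
    by (metis add.m_closed one_closed)
  have sg: "subgroup M (add_monoid R)" and ri: "\<And>x a. x \<in> M \<Longrightarrow> a \<in> carrier R \<Longrightarrow> x \<otimes> a \<in> M"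
    and ne: "M \<noteq> carrier R"
    using M(1) by (auto simp: maximal_right_ideal_def right_ideal_def)
  have "(\<one> \<oplus> j) \<otimes> \<one> \<in> M" using M(2) by blast
  then have 1: "\<one> \<oplus> j \<in> M" using jc by simp
  have "j \<in> M" using j M(1) by (auto simp: jacobson_radical_def)
  then have "\<ominus> j \<in> M" using subgroup.m_inv_closed[OF sg, of j] by (simp add: a_inv_def)
  with 1 have "(\<one> \<oplus> j) \<oplus> \<ominus> j \<in> M" using subgroup.m_closed[OF sg] by force
  then have "\<one> \<in> M" using jc by (simp add: a_assoc r_neg)
  then have "carrier R \<subseteq> M" using ri by force
  moreover have "M \<subseteq> carrier R" using subgroup.subset[OF sg] by simp
  ultimately show False using ne by blast
qed

text \<open>An inverse of the coset of \<open>a\<close> in the quotient by the radical \<open>J\<close> gives \<open>b\<close> with both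
  \<open>ab\<close> and \<open>ba\<close> in \<open>1 + J\<close>, hence with both products invertible.\<close>

lemma local_ring_Units:
  assumes fin: "finite (carrier R)" and dr: "division_ring (R Quot jacobson_radical R)"
    and a: "a \<in> carrier R" "a \<notin> jacobson_radical R"
  shows "a \<in> Units R"
proof -
  let ?J = "jacobson_radical R" and ?Q = "R Quot jacobson_radical R"
  have mem: "x \<in> ?J +>\<^bsub>R\<^esub> x" if "x \<in> carrier R" for x
    unfolding a_r_coset_def' using jacobson_radical_closed(2) that
    by (metis (mono_tags, lifting) UN_I insertI1 l_zero)
  have carr: "carrier ?Q = {?J +>\<^bsub>R\<^esub> x | x. x \<in> carrier R}"
    by (auto simp: FactRing_def A_RCOSETS_def' a_r_coset_def')
  have "?J +>\<^bsub>R\<^esub> a \<noteq> ?J" using mem[OF a(1)] a(2) by auto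
  then have "?J +>\<^bsub>R\<^esub> a \<in> Units ?Q"
    using dr a(1) carr by (auto simp: division_ring_def FactRing_def)
  then obtain B where B: "B \<in> carrier ?Q" "(?J +>\<^bsub>R\<^esub> a) \<otimes>\<^bsub>?Q\<^esub> B = ?J +>\<^bsub>R\<^esub> \<one>"
    by (auto simp: Units_def FactRing_def)
  then obtain b where b: "b \<in> carrier R" "B = ?J +>\<^bsub>R\<^esub> b" using carr by auto
  have "a \<otimes> b \<in> (?J +>\<^bsub>R\<^esub> a) \<otimes>\<^bsub>?Q\<^esub> B"
    unfolding b(2) using mem[OF a(1)] mem[OF b(1)] mem[of "a \<otimes> b"] a(1) b(1)
    by (auto simp: FactRing_def rcoset_mult_def)
  then have "a \<otimes> b \<in> ?J +>\<^bsub>R\<^esub> \<one>" using B by simp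
  then obtain j where j: "j \<in> ?J" "a \<otimes> b = j \<oplus> \<one>" by (auto simp: a_r_coset_def')
  then have "a \<otimes> b = \<one> \<oplus> j"
    using jacobson_radical_closed(1) by (auto simp: a_comm)
  then have "a \<otimes> b \<in> Units R" using one_plus_jacobson_radical_Units[OF fin j(1)] by simp
  then have "a \<otimes> (b \<otimes> inv (a \<otimes> b)) = \<one>"
    using a b by (metis Units_inv_closed Units_r_inv m_assoc)
  then show ?thesis
    using right_invertible_imp_Units[OF fin a(1), of "b \<otimes> inv (a \<otimes> b)"] b \<open>a \<otimes> b \<in> Units R\<close>
    by simp
qed

lemma local_ring_radical_not_Units:
  assumes fin: "finite (carrier R)" and dr: "division_ring (R Quot jacobson_radical R)"
    and a: "a \<in> jacobson_radical R"
  shows "a \<notin> Units R"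
proof
  assume "a \<in> Units R"
  then have "\<one> \<in> jacobson_radical R"
    using jacobson_radical_closed(5)[OF a] by (metis Units_inv_closed Units_r_inv)
  then have "\<one> \<oplus> \<ominus> \<one> \<in> Units R"
    using one_plus_jacobson_radical_Units[OF fin] jacobson_radical_closed(4) by blast
  then have "\<zero> \<in> Units R" by (simp add: r_neg)
  then have "\<one> = \<zero>"
    by (metis Units_inv_closed Units_r_inv l_null)
  moreover have "jacobson_radical R +>\<^bsub>R\<^esub> \<one> \<noteq> jacobson_radical R"
    using dr by (simp add: division_ring_def FactRing_def)
  moreover have "jacobson_radical R +>\<^bsub>R\<^esub> \<zero> = jacobson_radical R"
    using jacobson_radical_closed(1) by (intro a_coset_add_zero)
  ultimately show False by simp
qed

lemma local_ring_Units_add_radical: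
  assumes fin: "finite (carrier R)" and dr: "division_ring (R Quot jacobson_radical R)"
    and a: "a \<in> Units R" "j \<in> jacobson_radical R"
  shows "a \<oplus> j \<in> Units R"
proof (rule ccontr)
  have c: "a \<in> carrier R" "j \<in> carrier R" using a jacobson_radical_closed(1) by auto
  assume "a \<oplus> j \<notin> Units R"
  then have "a \<oplus> j \<in> jacobson_radical R"
    using local_ring_Units[OF fin dr] c by blast
  then have "(a \<oplus> j) \<oplus> \<ominus> j \<in> jacobson_radical R"
    using a jacobson_radical_closed by blast
  then have "a \<in> jacobson_radical R" using c by (simp add: a_assoc r_neg)
  with local_ring_radical_not_Units[OF fin dr] a show False by blast
qed

end

section \<open>Rings with involution\<close>

locale local_star_ring = finite_local_involution_ring A star
  for A :: "('a, 'r) ring_scheme" (structure) and star :: "'a \<Rightarrow> 'a"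

sublocale local_star_ring \<subseteq> ring A
  using local by (simp add: local_ring_def)

context local_star_ring
begin

abbreviation Fix :: "'a set" where "Fix \<equiv> carrier (fixed_ring A star)"
abbreviation rad :: "'a set" where "rad \<equiv> jacobson_radical A"

lemma Fix_iff: "a \<in> Fix \<longleftrightarrow> a \<in> carrier A \<and> star a = a"
  by (simp add: fixed_ring_def)

lemma fixed_ring_simps [simp]:
  "monoid.mult (fixed_ring A star) = monoid.mult A" "monoid.one (fixed_ring A star) = \<one>"
  "ring.add (fixed_ring A star) = ring.add A" "ring.zero (fixed_ring A star) = \<zero>"
  by (simp_all add: fixed_ring_def)

lemma star_hom: "star \<in> ring_hom A (opposite_ring A)"
  using involution by (simp add: ring_involution_def ring_iso_def)

lemma star_closed [simp, intro]: "a \<in> carrier A \<Longrightarrow> star a \<in> carrier A"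
  using star_hom by (auto simp: ring_hom_def opposite_ring_def)

lemma star_add [simp]: "a \<in> carrier A \<Longrightarrow> b \<in> carrier A \<Longrightarrow> star (a \<oplus> b) = star a \<oplus> star b"
  using star_hom by (auto simp: ring_hom_def opposite_ring_def)

lemma star_mult [simp]: "a \<in> carrier A \<Longrightarrow> b \<in> carrier A \<Longrightarrow> star (a \<otimes> b) = star b \<otimes> star a"
  using star_hom by (auto simp: ring_hom_def opposite_ring_def)

lemma star_one [simp]: "star \<one> = \<one>"
  using star_hom by (auto simp: ring_hom_def opposite_ring_def)

lemma star_star [simp]: "a \<in> carrier A \<Longrightarrow> star (star a) = a"
  using involution by (simp add: ring_involution_def)

lemma star_zero [simp]: "star \<zero> = \<zero>"
proof -
  have "star \<zero> \<oplus> star \<zero> = star \<zero> \<oplus> \<zero>"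
    using star_add[of \<zero> \<zero>] by (simp del: star_add)
  then show ?thesis by (simp del: r_zero)
qed

lemma star_minus [simp]: "a \<in> carrier A \<Longrightarrow> star (\<ominus> a) = \<ominus> star a"
  using star_add[of a "\<ominus> a"] by (intro minus_equality[symmetric]) (simp_all del: star_add add: star_add[symmetric] l_neg)

lemma star_inv: "a \<in> Units A \<Longrightarrow> star a \<in> Units A \<and> inv (star a) = star (inv a)"
proof -
  assume a: "a \<in> Units A"
  have 1: "star a \<otimes> star (inv a) = \<one>" "star (inv a) \<otimes> star a = \<one>"
    using a by (metis Units_closed Units_inv_closed Units_l_inv Units_r_inv star_mult star_one)+
  have "star a \<in> Units A"
    using 1 Units_closed[OF a] Units_inv_closed[OF a] unfolding Units_def
    by (intro CollectI conjI bexI[of _ "star (inv a)"]) auto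
  moreover have "inv (star a) = star (inv a)"
    using 1 a by (intro inv_char) auto
  ultimately show ?thesis by blast
qed

lemma fixed_carrier: "r \<in> Fix \<Longrightarrow> r \<in> carrier A"
  by (simp add: Fix_iff)

lemma fixed_star: "r \<in> Fix \<Longrightarrow> star r = r"
  by (simp add: Fix_iff)

lemma fixed_comm: "r \<in> Fix \<Longrightarrow> a \<in> carrier A \<Longrightarrow> r \<otimes> a = a \<otimes> r"
  using fixed_central by blast

sublocale fixed: cring "fixed_ring A star"
  rewrites "monoid.mult (fixed_ring A star) = monoid.mult A" and "monoid.one (fixed_ring A star) = \<one>"
    and "ring.add (fixed_ring A star) = ring.add A" and "ring.zero (fixed_ring A star) = \<zero>"
proof -
  have "ring (fixed_ring A star)" using fixed_local by (simp add: local_ring_def)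
  then interpret R: ring "fixed_ring A star" .
  show "cring (fixed_ring A star)"
    using fixed_comm Fix_iff by unfold_locales auto
qed simp_all

lemma fixed_minus: "r \<in> Fix \<Longrightarrow> a_inv (fixed_ring A star) r = \<ominus> r"
  using fixed.l_neg[of r] fixed.a_inv_closed[of r] fixed_carrier
  by (intro minus_equality[symmetric]) auto

lemma fixed_minus_closed: "r \<in> Fix \<Longrightarrow> \<ominus> r \<in> Fix"
  using fixed_minus fixed.a_inv_closed by metis

lemma fixed_inv_closed: "r \<in> Fix \<Longrightarrow> r \<in> Units A \<Longrightarrow> inv r \<in> Fix"
  using star_inv[of r] by (auto simp: Fix_iff)

lemma add_star_fixed: "a \<in> carrier A \<Longrightarrow> a \<oplus> star a \<in> Fix"
  by (auto simp: Fix_iff a_comm)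

lemma nonunit_in_rad: "a \<in> carrier A \<Longrightarrow> a \<notin> rad \<Longrightarrow> a \<in> Units A"
  using local finite_carrier local_ring_Units by (auto simp: local_ring_def)

lemma Units_add_rad: "a \<in> Units A \<Longrightarrow> j \<in> rad \<Longrightarrow> a \<oplus> j \<in> Units A"
  using local finite_carrier local_ring_Units_add_radical by (auto simp: local_ring_def)

lemma Fix_subset: "Fix \<subseteq> carrier A"
  by (auto simp: Fix_iff)

lemma fixed_Units: "r \<in> Units (fixed_ring A star) \<Longrightarrow> r \<in> Units A \<and> r \<in> Fix"
  unfolding Units_def by (auto dest: fixed_carrier)

lemma fixed_nonunit_in_rad:
  assumes "r \<in> Fix" "r \<notin> Units (fixed_ring A star)"
  shows "r \<in> rad"
proof -
  have "finite Fix" using finite_carrier Fix_subset by (rule rev_finite_subset)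
  then have "r \<in> jacobson_radical (fixed_ring A star)"
    using fixed.local_ring_Units fixed_local assms by (auto simp: local_ring_def)
  then show ?thesis by (simp add: fixed_jacobson fixed_radical_def)
qed

text \<open>If \<open>2\<close> were in the radical, the order of \<open>1\<close> in the residue field would divide \<open>2\<close>;
  being odd, it would be \<open>1\<close>.\<close>

lemma two_Units: "\<one> \<oplus> \<one> \<in> Units A"
proof (rule ccontr)
  let ?J = "fixed_radical A star" and ?R = "fixed_ring A star"
  let ?K = "?R Quot ?J"
  assume "\<one> \<oplus> \<one> \<notin> Units A"
  then have "\<one> \<oplus> \<one> \<in> rad" using nonunit_in_rad by blast
  then have two: "\<one> \<oplus> \<one> \<in> ?J" by (simp add: fixed_radical_def Fix_iff)
  interpret K: field ?K by (rule residue_field)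
  interpret J: abelian_subgroup ?J ?R
    using fixed.jacobson_radical_subgroup
    by (intro abelian_subgroupI3 additive_subgroup.intro) (simp_all add: fixed_jacobson fixed.is_abelian_group)
  have one: "\<one> \<in> Fix" by (simp add: Fix_iff)
  have "\<one>\<^bsub>?K\<^esub> \<oplus>\<^bsub>?K\<^esub> \<one>\<^bsub>?K\<^esub> = ?J +>\<^bsub>?R\<^esub> (\<one> \<oplus> \<one>)"
    using J.a_rcos_sum[OF one one] by (simp add: FactRing_def)
  also have "\<dots> = ?J"
    using J.a_rcos_const two by blast
  finally have "\<one>\<^bsub>?K\<^esub> \<oplus>\<^bsub>?K\<^esub> \<one>\<^bsub>?K\<^esub> = \<zero>\<^bsub>?K\<^esub>"
    by (simp add: FactRing_def)
  then have "\<one>\<^bsub>?K\<^esub> [^]\<^bsub>add_monoid ?K\<^esub> (2::nat) = \<one>\<^bsub>add_monoid ?K\<^esub>"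
    by (simp add: numeral_2_eq_2 nat_pow_def K.l_zero)
  then have "ring_characteristic ?K dvd 2"
    using group.pow_eq_id[OF K.a_group, of "\<one>\<^bsub>?K\<^esub>" 2] by (simp add: ring_characteristic_def)
  then have "ring_characteristic ?K = 1"
    using odd_characteristic by (metis dvd_refl prime_nat_iff two_is_prime_nat)
  then have "\<one>\<^bsub>?K\<^esub> [^]\<^bsub>add_monoid ?K\<^esub> (1::nat) = \<one>\<^bsub>add_monoid ?K\<^esub>"
    using group.pow_eq_id[OF K.a_group, of "\<one>\<^bsub>?K\<^esub>" 1] by (simp add: ring_characteristic_def)
  then show False
    by (simp add: K.add.nat_pow_Suc add_pow_def nat_pow_def)
qed

abbreviation half :: 'a where "half \<equiv> inv (\<one> \<oplus> \<one>)"

lemma half_fixed: "half \<in> Fix"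
  using two_Units by (intro fixed_inv_closed) (auto simp: Fix_iff)

lemma half_double: "a \<in> carrier A \<Longrightarrow> half \<otimes> a \<oplus> half \<otimes> a = a"
proof -
  assume a: "a \<in> carrier A"
  have h: "half \<in> carrier A" using half_fixed fixed_carrier by blast
  have "half \<otimes> a \<oplus> half \<otimes> a = (half \<otimes> (\<one> \<oplus> \<one>)) \<otimes> a"
    using a h by (simp add: r_distr l_distr)
  also have "half \<otimes> (\<one> \<oplus> \<one>) = \<one>" using two_Units by simp
  finally show ?thesis using a by simp
qed

lemma double_cancel:
  assumes "a \<in> carrier A" "b \<in> carrier A" "a \<oplus> a = b \<oplus> b"
  shows "a = b"
proof -
  have h: "half \<in> carrier A" using half_fixed fixed_carrier by blast
  have "half \<otimes> (c \<oplus> c) = c" if "c \<in> carrier A" for c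
    using that h by (simp add: r_distr half_double)
  then show ?thesis using assms by metis
qed

text \<open>The difference of two values factors as \<open>(x - x')(2 - r(x + x'))\<close>, and the second factor
  is a unit; a finite injective self-map is bijective.\<close>

lemma fixed_quadratic_bij:
  assumes r: "r \<in> Fix" "r \<in> rad"
  shows "bij_betw (\<lambda>x. x \<oplus> x \<ominus> r \<otimes> (x \<otimes> x)) Fix Fix"
proof -
  let ?f = "\<lambda>x. x \<oplus> x \<ominus> r \<otimes> (x \<otimes> x)"
  have minus: "a \<ominus> b = a_minus (fixed_ring A star) a b" if "b \<in> Fix" for a b
    using that fixed_minus by (simp add: a_minus_def)
  have cl: "?f x \<in> Fix" if "x \<in> Fix" for x
    using that r(1) minus by simp
  have inj: "x = y" if xy: "x \<in> Fix" "y \<in> Fix" "?f x = ?f y" for x y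
  proof -
    have c: "x \<in> carrier A" "y \<in> carrier A" "r \<in> carrier A" using xy r fixed_carrier by auto
    have com: "y \<otimes> x = x \<otimes> y" using fixed_comm xy c by auto
    \<comment> \<open>\<open>2 - r(x + y)\<close>, written as a unit plus a right multiple of \<open>r\<close>\<close>
    let ?e = "(\<one> \<oplus> \<one>) \<oplus> r \<otimes> \<ominus> (x \<oplus> y)"
    have e: "?e \<in> Units A"
      using Units_add_rad[OF two_Units jacobson_radical_closed(5)[OF r(2)]] c by simp
    have "?e \<otimes> (x \<ominus> y) = (x \<oplus> x \<ominus> r \<otimes> (x \<otimes> x)) \<ominus> (y \<oplus> y \<ominus> r \<otimes> (y \<otimes> y))
        \<oplus> (r \<otimes> (x \<otimes> y) \<ominus> r \<otimes> (y \<otimes> x))"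
      using c by algebra
    also have "\<dots> = \<zero>" using c xy(3) com by (simp add: a_minus_def r_neg)
    finally have "inv ?e \<otimes> (?e \<otimes> (x \<ominus> y)) = \<zero>" using e by simp
    then have "(inv ?e \<otimes> ?e) \<otimes> (x \<ominus> y) = \<zero>"
      using e c by (subst m_assoc) auto
    then have "x \<ominus> y = \<zero>" using e c by simp
    then show ?thesis using c by (simp add: a_minus_def add.inv_solve_right')
  qed
  have "finite Fix" using finite_carrier Fix_subset by (rule rev_finite_subset)
  moreover have "?f ` Fix \<subseteq> Fix" using cl by auto
  moreover have "inj_on ?f Fix" using inj by (rule inj_onI)
  ultimately show ?thesis
    using endo_inj_surj by (simp add: bij_betw_def)
qed

abbreviation Skew :: "'a set" where "Skew \<equiv> {y \<in> carrier A. star y = \<ominus> y}"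

lemma fixed_plus_skew_inj:
  assumes "x \<in> Fix" "x' \<in> Fix" "y \<in> Skew" "y' \<in> Skew" "x \<oplus> y = x' \<oplus> y'"
  shows "x = x' \<and> y = y'"
proof -
  have c: "x \<in> carrier A" "x' \<in> carrier A" "y \<in> carrier A" "y' \<in> carrier A"
    using assms fixed_carrier by auto
  have "star x \<oplus> star y = star x' \<oplus> star y'" using assms(5) c by (metis star_add)
  then have 1: "x \<ominus> y = x' \<ominus> y'" using assms c by (simp add: fixed_star a_minus_def)
  have "x \<oplus> x = (x \<oplus> y) \<oplus> (x \<ominus> y)" using c by algebra
  also have "\<dots> = (x' \<oplus> y') \<oplus> (x' \<ominus> y')" using assms(5) 1 by simp
  also have "\<dots> = x' \<oplus> x'" using c by algebra
  finally have "x = x'" using double_cancel c by blast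
  with assms(5) c show ?thesis by simp
qed

lemma fixed_plus_skew_surj:
  assumes a: "a \<in> carrier A"
  shows "\<exists>x\<in>Fix. \<exists>y\<in>Skew. a = x \<oplus> y"
proof (intro bexI)
  have h: "half \<in> carrier A" using half_fixed fixed_carrier by blast
  have hc: "star b \<otimes> half = half \<otimes> star b" if "b \<in> carrier A" for b
    using fixed_comm[OF half_fixed] that by simp
  let ?x = "half \<otimes> (a \<oplus> star a)" and ?y = "half \<otimes> (a \<ominus> star a)"
  have "?x \<oplus> ?y = half \<otimes> a \<oplus> half \<otimes> a"
    using a h star_closed[OF a] by algebra
  then show "a = ?x \<oplus> ?y" using a half_double by simp
  show "?x \<in> Fix" using half_fixed add_star_fixed[OF a] by simp
  have "star ?y = (star a \<ominus> a) \<otimes> half"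
    using a h fixed_star[OF half_fixed] by (simp add: a_minus_def)
  also have "\<dots> = half \<otimes> (star a \<ominus> a)"
    using fixed_comm[OF half_fixed] a by simp
  also have "\<dots> = \<ominus> ?y" using a h star_closed[OF a] by algebra
  finally show "?y \<in> Skew" using a h by simp
qed

lemma card_fixed_mult_card_skew: "card Fix * card Skew = card (carrier A)"
proof -
  have "bij_betw (\<lambda>(x, y). x \<oplus> y) (Fix \<times> Skew) (carrier A)"
  proof (rule bij_betw_imageI)
    show "inj_on (\<lambda>(x, y). x \<oplus> y) (Fix \<times> Skew)"
    proof (rule inj_onI, clarify)
      fix x y x' y'
      assume "x \<in> Fix" "y \<in> carrier A" "star y = \<ominus> y"
        "x' \<in> Fix" "y' \<in> carrier A" "star y' = \<ominus> y'" "x \<oplus> y = x' \<oplus> y'"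
      then show "x = x' \<and> y = y'" using fixed_plus_skew_inj[of x x' y y'] by simp
    qed
    show "(\<lambda>(x, y). x \<oplus> y) ` (Fix \<times> Skew) = carrier A"
    proof (intro equalityI subsetI)
      fix a assume "a \<in> carrier A"
      then obtain x y where "x \<in> Fix" "y \<in> Skew" "a = x \<oplus> y" using fixed_plus_skew_surj by blast
      then show "a \<in> (\<lambda>(x, y). x \<oplus> y) ` (Fix \<times> Skew)" by (intro image_eqI[of _ _ "(x, y)"]) simp_all
    qed (use fixed_carrier in auto)
  qed
  then show ?thesis
    by (simp add: bij_betw_same_card[symmetric] card_cartesian_product)
qed

text \<open>Write \<open>a = x + y\<close> with \<open>x\<close> fixed and \<open>y\<close> skew.  As \<open>x\<close> is central the equation becomes
  \<open>2x - r x\<^sup>2 = s - r y\<^sup>2\<close>, so every skew \<open>y\<close> contributes exactly one solution.\<close>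

lemma card_hermitian_quadratic_solutions:
  assumes r: "r \<in> Fix" "r \<in> rad" and s: "s \<in> Fix"
  shows "card {a \<in> carrier A. a \<oplus> star a \<ominus> r \<otimes> (star a \<otimes> a) = s} = card Skew"
proof -
  let ?f = "\<lambda>x. x \<oplus> x \<ominus> r \<otimes> (x \<otimes> x)"
  let ?S = "{a \<in> carrier A. a \<oplus> star a \<ominus> r \<otimes> (star a \<otimes> a) = s}"
  have rc: "r \<in> carrier A" and sc: "s \<in> carrier A" using r s fixed_carrier by auto
  have split: "(x \<oplus> y) \<oplus> star (x \<oplus> y) \<ominus> r \<otimes> (star (x \<oplus> y) \<otimes> (x \<oplus> y)) = ?f x \<oplus> r \<otimes> (y \<otimes> y)"
    if "x \<in> Fix" "y \<in> Skew" for x y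
  proof -
    have c: "x \<in> carrier A" "y \<in> carrier A" using that fixed_carrier by auto
    have com: "y \<otimes> x = x \<otimes> y" using fixed_comm[OF that(1) c(2)] by simp
    have st: "star (x \<oplus> y) = x \<ominus> y" using that c by (simp add: fixed_star a_minus_def)
    have "(x \<oplus> y) \<oplus> (x \<ominus> y) \<ominus> r \<otimes> ((x \<ominus> y) \<otimes> (x \<oplus> y))
        = ?f x \<oplus> r \<otimes> (y \<otimes> y) \<oplus> (r \<otimes> (y \<otimes> x) \<ominus> r \<otimes> (x \<otimes> y))"
      using c rc by algebra
    also have "\<dots> = ?f x \<oplus> r \<otimes> (y \<otimes> y)" using c rc by (simp add: com a_minus_def r_neg)
    finally show ?thesis by (simp only: st)
  qed
  have ex: "\<exists>x\<in>Fix. ?f x = s \<ominus> r \<otimes> (y \<otimes> y)" if y: "y \<in> Skew" for y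
  proof -
    have "y \<otimes> y \<in> Fix" using y by (simp add: Fix_iff l_minus r_minus)
    then have "s \<ominus> r \<otimes> (y \<otimes> y) \<in> Fix"
      using r s fixed_minus_closed by (simp add: a_minus_def)
    then have "s \<ominus> r \<otimes> (y \<otimes> y) \<in> ?f ` Fix"
      using bij_betw_imp_surj_on[OF fixed_quadratic_bij[OF r]] by simp
    then show ?thesis by (metis (no_types, lifting) imageE)
  qed
  define \<xi> where "\<xi> y = (SOME x. x \<in> Fix \<and> ?f x = s \<ominus> r \<otimes> (y \<otimes> y))" for y
  have "\<xi> y \<in> Fix \<and> ?f (\<xi> y) = s \<ominus> r \<otimes> (y \<otimes> y)" if "y \<in> Skew" for y
    unfolding \<xi>_def by (rule someI_ex) (use ex[OF that] in blast)
  then have \<xi>: "\<xi> y \<in> Fix" "?f (\<xi> y) = s \<ominus> r \<otimes> (y \<otimes> y)" if "y \<in> Skew" for y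
    using that by blast+
  have inj: "inj_on (\<lambda>y. \<xi> y \<oplus> y) Skew"
  proof (rule inj_onI)
    fix y y' assume y: "y \<in> Skew" "y' \<in> Skew" and eq: "\<xi> y \<oplus> y = \<xi> y' \<oplus> y'"
    show "y = y'" by (rule conjunct2[OF fixed_plus_skew_inj[OF \<xi>(1)[OF y(1)] \<xi>(1)[OF y(2)] y eq]])
  qed
  moreover have "(\<lambda>y. \<xi> y \<oplus> y) ` Skew = ?S"
  proof (intro equalityI subsetI)
    fix a assume "a \<in> (\<lambda>y. \<xi> y \<oplus> y) ` Skew"
    then obtain y where y: "y \<in> Skew" "a = \<xi> y \<oplus> y" by blast
    have "a \<oplus> star a \<ominus> r \<otimes> (star a \<otimes> a) = (s \<ominus> r \<otimes> (y \<otimes> y)) \<oplus> r \<otimes> (y \<otimes> y)"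
      unfolding y(2) split[OF \<xi>(1)[OF y(1)] y(1)] \<xi>(2)[OF y(1)] ..
    also have "\<dots> = s" using y rc sc by (simp add: a_minus_def a_assoc l_neg)
    finally show "a \<in> ?S" using y \<xi>(1) fixed_carrier by auto
  next
    fix a assume a: "a \<in> ?S"
    then obtain x y where xy: "x \<in> Fix" "y \<in> Skew" "a = x \<oplus> y"
      using fixed_plus_skew_surj by blast
    have xc: "x \<in> carrier A" using xy fixed_carrier by auto
    have "?f x \<oplus> r \<otimes> (y \<otimes> y) = s" using a split[OF xy(1,2)] xy(3) by simp
    moreover have "?f x = (?f x \<oplus> r \<otimes> (y \<otimes> y)) \<ominus> r \<otimes> (y \<otimes> y)"
      using xc xy(2) rc by (simp add: a_minus_def a_assoc r_neg)
    ultimately have eq: "?f x = ?f (\<xi> y)" using \<xi>(2)[OF xy(2)] by simp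
    have "x = \<xi> y"
      by (rule inj_onD[OF bij_betw_imp_inj_on[OF fixed_quadratic_bij[OF r]] eq xy(1) \<xi>(1)[OF xy(2)]])
    then show "a \<in> (\<lambda>y. \<xi> y \<oplus> y) ` Skew" using xy by blast
  qed
  ultimately show ?thesis using card_image[OF inj] by (simp only:)
qed

end

section \<open>Right modules with a basis\<close>

lemma additive_map_finsum:
  assumes "abelian_group G" "abelian_group H"
    and F: "\<And>x. x \<in> carrier G \<Longrightarrow> F x \<in> carrier H"
    and add: "\<And>x y. x \<in> carrier G \<Longrightarrow> y \<in> carrier G \<Longrightarrow> F (x \<oplus>\<^bsub>G\<^esub> y) = F x \<oplus>\<^bsub>H\<^esub> F y"
    and "finite I" "g \<in> I \<rightarrow> carrier G"
  shows "F (\<Oplus>\<^bsub>G\<^esub>i\<in>I. g i) = (\<Oplus>\<^bsub>H\<^esub>i\<in>I. F (g i))"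
proof -
  interpret G: abelian_group G by fact
  interpret H: abelian_group H by fact
  have zero: "F \<zero>\<^bsub>G\<^esub> = \<zero>\<^bsub>H\<^esub>"
    using add[of "\<zero>\<^bsub>G\<^esub>" "\<zero>\<^bsub>G\<^esub>"] F[of "\<zero>\<^bsub>G\<^esub>"] by simp
  show ?thesis
    using assms(5,6)
  proof (induction rule: finite_induct)
    case (insert i I)
    then have "g i \<in> carrier G" "g \<in> I \<rightarrow> carrier G" "(\<lambda>i. F (g i)) \<in> I \<rightarrow> carrier H"
      using F by auto
    with insert F show ?case by (simp add: add G.finsum_insert H.finsum_insert G.finsum_closed)
  qed (simp add: zero)
qed

sublocale right_module \<subseteq> A: ring A
  by (rule scalar_ring)

sublocale right_module \<subseteq> V: abelian_group V
  by (rule vector_group)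

context right_module
begin

lemma smult_zero_scalar [simp]: "v \<in> carrier V \<Longrightarrow> \<zero>\<^bsub>A\<^esub> \<odot>\<^bsub>V\<^esub> v = \<zero>\<^bsub>V\<^esub>"
  using smult_l_distr[of "\<zero>\<^bsub>A\<^esub>" "\<zero>\<^bsub>A\<^esub>" v] smult_closed[of "\<zero>\<^bsub>A\<^esub>" v] by simp

lemma smult_zero_vector [simp]: "a \<in> carrier A \<Longrightarrow> a \<odot>\<^bsub>V\<^esub> \<zero>\<^bsub>V\<^esub> = \<zero>\<^bsub>V\<^esub>"
  using smult_r_distr[of a "\<zero>\<^bsub>V\<^esub>" "\<zero>\<^bsub>V\<^esub>"] smult_closed[of a "\<zero>\<^bsub>V\<^esub>"] by simp

lemma smult_minus_one: "v \<in> carrier V \<Longrightarrow> (\<ominus>\<^bsub>A\<^esub> \<one>\<^bsub>A\<^esub>) \<odot>\<^bsub>V\<^esub> v = \<ominus>\<^bsub>V\<^esub> v"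
  using smult_l_distr[of "\<ominus>\<^bsub>A\<^esub> \<one>\<^bsub>A\<^esub>" "\<one>\<^bsub>A\<^esub>" v] smult_closed[of "\<ominus>\<^bsub>A\<^esub> \<one>\<^bsub>A\<^esub>" v] smult_one[of v]
  by (intro V.minus_equality[symmetric]) (auto simp: A.l_neg)

lemma smult_finsum:
  assumes "a \<in> carrier A" "finite I" "g \<in> I \<rightarrow> carrier V"
  shows "a \<odot>\<^bsub>V\<^esub> (\<Oplus>\<^bsub>V\<^esub>i\<in>I. g i) = (\<Oplus>\<^bsub>V\<^esub>i\<in>I. a \<odot>\<^bsub>V\<^esub> g i)"
  by (rule additive_map_finsum[OF vector_group vector_group])
     (use assms smult_closed smult_r_distr in auto)

lemma basis_vector: "is_basis A V n b \<Longrightarrow> i < n \<Longrightarrow> b i \<in> carrier V"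
  by (simp add: is_basis_def)

lemma basis_term_closed:
  "is_basis A V n b \<Longrightarrow> c \<in> {..<n} \<rightarrow> carrier A \<Longrightarrow> (\<lambda>i. c i \<odot>\<^bsub>V\<^esub> b i) \<in> {..<n} \<rightarrow> carrier V"
  using basis_vector smult_closed by (auto simp: Pi_def)

lemma basis_bij_betw_coordinates:
  assumes b: "is_basis A V n b"
  shows "bij_betw (\<lambda>c. \<Oplus>\<^bsub>V\<^esub>i\<in>{..<n}. c i \<odot>\<^bsub>V\<^esub> b i) ({..<n} \<rightarrow>\<^sub>E carrier A) (carrier V)"
proof -
  have cl: "(\<Oplus>\<^bsub>V\<^esub>i\<in>{..<n}. c i \<odot>\<^bsub>V\<^esub> b i) \<in> carrier V" if "c \<in> {..<n} \<rightarrow>\<^sub>E carrier A" for c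
    using basis_term_closed[OF b] that by (intro V.finsum_closed) (auto simp: PiE_def)
  show ?thesis
  proof (rule bij_betw_imageI)
    show "inj_on (\<lambda>c. \<Oplus>\<^bsub>V\<^esub>i\<in>{..<n}. c i \<odot>\<^bsub>V\<^esub> b i) ({..<n} \<rightarrow>\<^sub>E carrier A)"
    proof (rule inj_onI)
      fix c d assume cd: "c \<in> {..<n} \<rightarrow>\<^sub>E carrier A" "d \<in> {..<n} \<rightarrow>\<^sub>E carrier A"
        "(\<Oplus>\<^bsub>V\<^esub>i\<in>{..<n}. c i \<odot>\<^bsub>V\<^esub> b i) = (\<Oplus>\<^bsub>V\<^esub>i\<in>{..<n}. d i \<odot>\<^bsub>V\<^esub> b i)"
      have "\<exists>!e. e \<in> {..<n} \<rightarrow>\<^sub>E carrier A \<and>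
          (\<Oplus>\<^bsub>V\<^esub>i\<in>{..<n}. c i \<odot>\<^bsub>V\<^esub> b i) = (\<Oplus>\<^bsub>V\<^esub>i\<in>{..<n}. e i \<odot>\<^bsub>V\<^esub> b i)"
        using b cl[OF cd(1)] unfolding is_basis_def by blast
      then show "c = d" using cd by blast
    qed
    show "(\<lambda>c. \<Oplus>\<^bsub>V\<^esub>i\<in>{..<n}. c i \<odot>\<^bsub>V\<^esub> b i) ` ({..<n} \<rightarrow>\<^sub>E carrier A) = carrier V"
      using b cl unfolding is_basis_def by (auto simp: image_iff)
  qed
qed

lemma card_free_module: "is_basis A V n b \<Longrightarrow> card (carrier V) = card (carrier A) ^ n"
  using bij_betw_same_card[OF basis_bij_betw_coordinates] by (simp add: card_PiE)

lemma finite_free_module: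
  "is_basis A V n b \<Longrightarrow> finite (carrier A) \<Longrightarrow> finite (carrier V)"
  using bij_betw_finite[OF basis_bij_betw_coordinates] by (simp add: finite_PiE)

lemma basis_induct [consumes 2, case_names zero basis add smult]:
  assumes b: "is_basis A V n b" and v: "v \<in> carrier V"
    and zero: "P \<zero>\<^bsub>V\<^esub>" and basis: "\<And>i. i < n \<Longrightarrow> P (b i)"
    and add: "\<And>v w. v \<in> carrier V \<Longrightarrow> w \<in> carrier V \<Longrightarrow> P v \<Longrightarrow> P w \<Longrightarrow> P (v \<oplus>\<^bsub>V\<^esub> w)"
    and smult: "\<And>a v. a \<in> carrier A \<Longrightarrow> v \<in> carrier V \<Longrightarrow> P v \<Longrightarrow> P (a \<odot>\<^bsub>V\<^esub> v)"
  shows "P v"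
proof -
  obtain c where c: "c \<in> {..<n} \<rightarrow>\<^sub>E carrier A" "v = (\<Oplus>\<^bsub>V\<^esub>i\<in>{..<n}. c i \<odot>\<^bsub>V\<^esub> b i)"
    using b v unfolding is_basis_def by blast
  have t: "c i \<odot>\<^bsub>V\<^esub> b i \<in> carrier V \<and> P (c i \<odot>\<^bsub>V\<^esub> b i)" if "i < n" for i
  proof -
    have "c i \<in> carrier A" using c(1) that by auto
    then show ?thesis using that basis basis_vector[OF b] smult smult_closed by simp
  qed
  have "finite I \<Longrightarrow> I \<subseteq> {..<n} \<Longrightarrow>
      (\<Oplus>\<^bsub>V\<^esub>i\<in>I. c i \<odot>\<^bsub>V\<^esub> b i) \<in> carrier V \<and> P (\<Oplus>\<^bsub>V\<^esub>i\<in>I. c i \<odot>\<^bsub>V\<^esub> b i)" for I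
  proof (induction I rule: finite_induct)
    case (insert i I)
    then have "c i \<odot>\<^bsub>V\<^esub> b i \<in> carrier V \<and> P (c i \<odot>\<^bsub>V\<^esub> b i)"
      "(\<lambda>i. c i \<odot>\<^bsub>V\<^esub> b i) \<in> I \<rightarrow> carrier V" using t by auto
    with insert add show ?case by (simp add: V.finsum_insert)
  qed (simp add: zero)
  then show ?thesis unfolding c(2) by blast
qed

end

lemma basis_linear_extension:
  assumes "right_module A V" "right_module A W" "is_basis A V n b"
    and c: "\<And>i. i < n \<Longrightarrow> c i \<in> carrier W"
  shows "\<exists>f\<in>right_module_hom A V W. \<forall>i<n. f (b i) = c i"
proof -
  interpret V: right_module A V by fact
  interpret W: right_module A W by fact
  note b = assms(3)
  let ?S = "\<lambda>x. \<Oplus>\<^bsub>V\<^esub>i\<in>{..<n}. x i \<odot>\<^bsub>V\<^esub> b i" and ?T = "\<lambda>x. \<Oplus>\<^bsub>W\<^esub>i\<in>{..<n}. x i \<odot>\<^bsub>W\<^esub> c i"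
  let ?C = "{..<n} \<rightarrow>\<^sub>E carrier A"
  define crd where "crd = the_inv_into ?C ?S"
  note bij = V.basis_bij_betw_coordinates[OF b]
  have crd: "crd v \<in> ?C" "?S (crd v) = v" if "v \<in> carrier V" for v
    using bij_betw_apply[OF bij_betw_the_inv_into[OF bij] that] f_the_inv_into_f_bij_betw[OF bij] that
    unfolding crd_def by blast+
  have crdI: "crd (?S x) = x" if "x \<in> ?C" for x
    unfolding crd_def by (rule the_inv_into_f_f[OF bij_betw_imp_inj_on[OF bij] that])
  have St: "(\<lambda>i. x i \<odot>\<^bsub>V\<^esub> b i) \<in> {..<n} \<rightarrow> carrier V" if "x \<in> ?C" for x
    using that V.basis_term_closed[OF b] by (auto simp: PiE_def)
  have Tt: "(\<lambda>i. x i \<odot>\<^bsub>W\<^esub> c i) \<in> {..<n} \<rightarrow> carrier W" if "x \<in> ?C" for x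
    using that c by (auto simp: PiE_def Pi_def W.smult_closed)
  have eqT: "?T (\<lambda>i\<in>{..<n}. x i) = ?T x" if "\<And>i. i < n \<Longrightarrow> x i \<in> carrier A" for x
    using that c by (intro W.V.finsum_cong') (auto simp: W.smult_closed)
  have eqS: "?S (\<lambda>i\<in>{..<n}. x i) = ?S x" if "\<And>i. i < n \<Longrightarrow> x i \<in> carrier A" for x
    using that V.basis_vector[OF b] by (intro V.V.finsum_cong') (auto simp: V.smult_closed)
  have xc: "x i \<in> carrier A" if "x \<in> ?C" "i < n" for x i using that by (auto simp: PiE_def)
  let ?f = "\<lambda>v. ?T (crd v)"
  have hom: "?f \<in> right_module_hom A V W"
    unfolding right_module_hom_def
  proof (intro CollectI conjI ballI)
    show "?f \<in> carrier V \<rightarrow> carrier W"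
      using crd(1) Tt by (auto intro!: W.V.finsum_closed)
  next
    fix v w assume vw: "v \<in> carrier V" "w \<in> carrier V"
    note x = crd[OF vw(1)] and y = crd[OF vw(2)]
    let ?z = "\<lambda>i. crd v i \<oplus>\<^bsub>A\<^esub> crd w i"
    have z: "\<And>i. i < n \<Longrightarrow> ?z i \<in> carrier A" using xc x(1) y(1) by auto
    have "?S ?z = (\<Oplus>\<^bsub>V\<^esub>i\<in>{..<n}. crd v i \<odot>\<^bsub>V\<^esub> b i \<oplus>\<^bsub>V\<^esub> crd w i \<odot>\<^bsub>V\<^esub> b i)"
      using xc[OF x(1)] xc[OF y(1)] V.basis_vector[OF b]
      by (intro V.V.finsum_cong') (auto simp: V.smult_closed V.smult_l_distr)
    also have "\<dots> = v \<oplus>\<^bsub>V\<^esub> w"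
      using V.V.finsum_addf[OF St[OF x(1)] St[OF y(1)]] x(2) y(2) by simp
    finally have "crd (v \<oplus>\<^bsub>V\<^esub> w) = (\<lambda>i\<in>{..<n}. ?z i)"
      using crdI[of "\<lambda>i\<in>{..<n}. ?z i"] eqS[OF z] z by auto
    then have "?f (v \<oplus>\<^bsub>V\<^esub> w) = ?T ?z" using eqT[OF z] by simp
    also have "\<dots> = (\<Oplus>\<^bsub>W\<^esub>i\<in>{..<n}. crd v i \<odot>\<^bsub>W\<^esub> c i \<oplus>\<^bsub>W\<^esub> crd w i \<odot>\<^bsub>W\<^esub> c i)"
      using xc[OF x(1)] xc[OF y(1)] c
      by (intro W.V.finsum_cong') (auto simp: W.smult_closed W.smult_l_distr)
    also have "\<dots> = ?f v \<oplus>\<^bsub>W\<^esub> ?f w"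
      using W.V.finsum_addf[OF Tt[OF x(1)] Tt[OF y(1)]] by simp
    finally show "?f (v \<oplus>\<^bsub>V\<^esub> w) = ?f v \<oplus>\<^bsub>W\<^esub> ?f w" .
  next
    fix a v assume av: "a \<in> carrier A" "v \<in> carrier V"
    note x = crd[OF av(2)]
    let ?z = "\<lambda>i. crd v i \<otimes>\<^bsub>A\<^esub> a"
    have z: "\<And>i. i < n \<Longrightarrow> ?z i \<in> carrier A" using xc x(1) av by auto
    have "?S ?z = (\<Oplus>\<^bsub>V\<^esub>i\<in>{..<n}. a \<odot>\<^bsub>V\<^esub> (crd v i \<odot>\<^bsub>V\<^esub> b i))"
      using xc[OF x(1)] av V.basis_vector[OF b]
      by (intro V.V.finsum_cong') (auto simp: V.smult_closed V.smult_assoc)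
    also have "\<dots> = a \<odot>\<^bsub>V\<^esub> v"
      using V.smult_finsum[OF av(1) _ St[OF x(1)]] x(2) by simp
    finally have "crd (a \<odot>\<^bsub>V\<^esub> v) = (\<lambda>i\<in>{..<n}. ?z i)"
      using crdI[of "\<lambda>i\<in>{..<n}. ?z i"] eqS[OF z] z by auto
    then have "?f (a \<odot>\<^bsub>V\<^esub> v) = ?T ?z" using eqT[OF z] by simp
    also have "\<dots> = (\<Oplus>\<^bsub>W\<^esub>i\<in>{..<n}. a \<odot>\<^bsub>W\<^esub> (crd v i \<odot>\<^bsub>W\<^esub> c i))"
      using xc[OF x(1)] av c
      by (intro W.V.finsum_cong') (auto simp: W.smult_closed W.smult_assoc)
    also have "\<dots> = a \<odot>\<^bsub>W\<^esub> ?f v"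
      using W.smult_finsum[OF av(1) _ Tt[OF x(1)]] by simp
    finally show "?f (a \<odot>\<^bsub>V\<^esub> v) = a \<odot>\<^bsub>W\<^esub> ?f v" .
  qed
  moreover have "?f (b i) = c i" if i: "i < n" for i
  proof -
    let ?e = "\<lambda>j. if i = j then \<one>\<^bsub>A\<^esub> else \<zero>\<^bsub>A\<^esub>"
    have e: "\<And>j. j < n \<Longrightarrow> ?e j \<in> carrier A" by simp
    have "?S ?e = (\<Oplus>\<^bsub>V\<^esub>j\<in>{..<n}. if i = j then b j else \<zero>\<^bsub>V\<^esub>)"
      using V.basis_vector[OF b]
      by (intro V.V.finsum_cong') (auto simp: V.smult_one)
    also have "\<dots> = b i"
      using i V.basis_vector[OF b] by (intro V.V.finsum_singleton) auto
    finally have "crd (b i) = (\<lambda>j\<in>{..<n}. ?e j)"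
      using crdI[of "\<lambda>j\<in>{..<n}. ?e j"] eqS[OF e] by auto
    then have "?f (b i) = ?T ?e" using eqT[OF e] by simp
    also have "\<dots> = (\<Oplus>\<^bsub>W\<^esub>j\<in>{..<n}. if i = j then c j else \<zero>\<^bsub>W\<^esub>)"
      using c by (intro W.V.finsum_cong') (auto simp: W.smult_one)
    also have "\<dots> = c i"
      using i c by (intro W.V.finsum_singleton) auto
    finally show ?thesis .
  qed
  ultimately show ?thesis by (intro bexI[OF _ hom] allI impI)
qed

section \<open>Isometries and reflections\<close>

definition isometries ::
  "('a, 'r) ring_scheme \<Rightarrow> ('a, 'v, 's) module_scheme \<Rightarrow> ('v \<Rightarrow> 'v \<Rightarrow> 'a)
    \<Rightarrow> ('a, 'w, 't) module_scheme \<Rightarrow> ('w \<Rightarrow> 'w \<Rightarrow> 'a) \<Rightarrow> ('v \<Rightarrow> 'w) set" where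
  "isometries A V h W k = {f \<in> right_module_hom A V W.
     \<forall>u\<in>carrier V. \<forall>v\<in>carrier V. k (f u) (f v) = h u v}"

lemma isometriesD:
  assumes "f \<in> isometries A V h W k"
  shows "v \<in> carrier V \<Longrightarrow> f v \<in> carrier W"
    and "v \<in> carrier V \<Longrightarrow> w \<in> carrier V \<Longrightarrow> f (v \<oplus>\<^bsub>V\<^esub> w) = f v \<oplus>\<^bsub>W\<^esub> f w"
    and "a \<in> carrier A \<Longrightarrow> v \<in> carrier V \<Longrightarrow> f (a \<odot>\<^bsub>V\<^esub> v) = a \<odot>\<^bsub>W\<^esub> f v"
    and "v \<in> carrier V \<Longrightarrow> w \<in> carrier V \<Longrightarrow> k (f v) (f w) = h v w"
  using assms by (auto simp: isometries_def right_module_hom_def)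

lemma isometriesI:
  assumes "\<And>v. v \<in> carrier V \<Longrightarrow> f v \<in> carrier W"
    and "\<And>v w. v \<in> carrier V \<Longrightarrow> w \<in> carrier V \<Longrightarrow> f (v \<oplus>\<^bsub>V\<^esub> w) = f v \<oplus>\<^bsub>W\<^esub> f w"
    and "\<And>a v. a \<in> carrier A \<Longrightarrow> v \<in> carrier V \<Longrightarrow> f (a \<odot>\<^bsub>V\<^esub> v) = a \<odot>\<^bsub>W\<^esub> f v"
    and "\<And>v w. v \<in> carrier V \<Longrightarrow> w \<in> carrier V \<Longrightarrow> k (f v) (f w) = h v w"
  shows "f \<in> isometries A V h W k"
  using assms by (auto simp: isometries_def right_module_hom_def)

lemma isometries_comp:
  assumes f: "f \<in> isometries A V h W k" and g: "g \<in> isometries A W k U l"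
  shows "(\<lambda>v. g (f v)) \<in> isometries A V h U l"
  using isometriesD[OF f] isometriesD[OF g] by (intro isometriesI) simp_all

locale hermitian_space =
  local_star_ring A star + right_module A V + hermitian_form A star V h
  for A :: "('a, 'r) ring_scheme" (structure) and star :: "'a \<Rightarrow> 'a"
    and V :: "('a, 'v, 's) module_scheme" and h :: "'v \<Rightarrow> 'v \<Rightarrow> 'a" +
  assumes nondegenerate: "nondegenerate_hermitian_form A star V h"
    and finite_vectors: "finite (carrier V)"

context hermitian_space
begin

declare h_closed [simp] smult_closed [simp] h_add_left [simp] h_add_right [simp] h_smult_right [simp]

lemma h_smult_left [simp]:
  "u \<in> carrier V \<Longrightarrow> v \<in> carrier V \<Longrightarrow> a \<in> carrier A \<Longrightarrow> h (a \<odot>\<^bsub>V\<^esub> u) v = star a \<otimes> h u v"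
  using h_star[of v "a \<odot>\<^bsub>V\<^esub> u"] h_star[of v u] by simp

lemma h_zero [simp]:
  "v \<in> carrier V \<Longrightarrow> h \<zero>\<^bsub>V\<^esub> v = \<zero>" "v \<in> carrier V \<Longrightarrow> h v \<zero>\<^bsub>V\<^esub> = \<zero>"
  using h_smult_left[of "\<zero>\<^bsub>V\<^esub>" v \<zero>] h_smult_right[of v "\<zero>\<^bsub>V\<^esub>" \<zero>] by simp_all

lemma h_minus [simp]:
  assumes "u \<in> carrier V" "v \<in> carrier V"
  shows "h (\<ominus>\<^bsub>V\<^esub> u) v = \<ominus> h u v" "h u (\<ominus>\<^bsub>V\<^esub> v) = \<ominus> h u v"
  using assms h_smult_left[of u v "\<ominus> \<one>"] h_smult_right[of u v "\<ominus> \<one>"]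
  by (simp_all add: smult_minus_one l_minus r_minus)

lemma length_fixed: "v \<in> carrier V \<Longrightarrow> h v v \<in> Fix"
  using h_star[of v v] by (simp add: Fix_iff)

lemma nondegenerate_eqI:
  assumes "u \<in> carrier V" "w \<in> carrier V" "\<And>v. v \<in> carrier V \<Longrightarrow> h u v = h w v"
  shows "u = w"
proof -
  have "inj_on (\<lambda>u. \<lambda>v\<in>carrier V. h u v) (carrier V)"
    using nondegenerate
    by (simp add: nondegenerate_hermitian_form_def right_module_iso_def bij_betw_def)
  moreover have "(\<lambda>v\<in>carrier V. h u v) = (\<lambda>v\<in>carrier V. h w v)"
    using assms(3) by (intro restrict_ext)
  ultimately show ?thesis using assms(1,2) by (rule inj_onD)
qed

lemma isometry_inj_on:
  assumes "f \<in> isometries A V h W k"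
  shows "inj_on f (carrier V)"
proof (rule inj_onI)
  fix u w assume uw: "u \<in> carrier V" "w \<in> carrier V" "f u = f w"
  show "u = w"
  proof (rule nondegenerate_eqI[OF uw(1,2)])
    fix v assume "v \<in> carrier V"
    then have "h u v = k (f u) (f v)" "h w v = k (f w) (f v)"
      using isometriesD(4)[OF assms uw(1)] isometriesD(4)[OF assms uw(2)] by simp_all
    then show "h u v = h w v" using uw by simp
  qed
qed

lemma isometry_bij_betw:
  assumes f: "f \<in> isometries A V h V h"
  shows "bij_betw f (carrier V) (carrier V)"
proof -
  have "f ` carrier V \<subseteq> carrier V" using isometriesD(1)[OF f] by auto
  then have "f ` carrier V = carrier V"
    using endo_inj_surj[OF finite_vectors] isometry_inj_on[OF f] by blast
  then show ?thesis using isometry_inj_on[OF f] by (simp add: bij_betw_def)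
qed

lemma carrier_unitary_group:
  "carrier (unitary_group A V h) = isometries A V h V h \<inter> extensional (carrier V)"
  using isometry_bij_betw
  by (auto simp: unitary_group_def right_module_iso_def isometries_def)

text \<open>The map \<open>x \<mapsto> x - z e\<^sup>-\<^sup>1 h(z, x)\<close> is an isometry as soon as \<open>e + e\<^sup>* = h(z, z)\<close>.  For
  \<open>z = v - w\<close> with \<open>v\<close> and \<open>w\<close> of the same length the choice \<open>e = h(z, v)\<close> has this property,
  and then \<open>v\<close> is sent to \<open>v - z = w\<close>.\<close>

lemma reflection:
  assumes v: "v \<in> carrier V" and w: "w \<in> carrier V" and len: "h v v = h w w"
    and unit: "h (v \<ominus>\<^bsub>V\<^esub> w) v \<in> Units A"
  shows "\<exists>g\<in>isometries A V h V h. g v = w \<and>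
    (\<forall>x\<in>carrier V. h v x = \<zero> \<and> h w x = \<zero> \<longrightarrow> g x = x)"
proof -
  define z where "z = v \<ominus>\<^bsub>V\<^esub> w"
  define e where "e = h z v"
  define d where "d = inv e"
  define g where "g x = x \<oplus>\<^bsub>V\<^esub> (\<ominus> (d \<otimes> h z x)) \<odot>\<^bsub>V\<^esub> z" for x
  have z: "z \<in> carrier V" using v w by (simp add: z_def)
  have e: "e \<in> Units A" "e \<in> carrier A" using unit v w by (auto simp: e_def z_def)
  have d: "d \<in> carrier A" "e \<otimes> d = \<one>" "d \<otimes> e = \<one>" using e by (auto simp: d_def)
  have hzz: "h z z = e \<oplus> star e"
  proof -
    have "star e = h v z" using h_star[OF z v] by (simp add: e_def)
    also have "h v z = \<ominus> h z w"
      using v w len by (simp add: z_def a_minus_def minus_add a_comm)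
    finally show ?thesis
      using v w z by (simp add: e_def) (simp add: z_def a_minus_def)
  qed
  have cl: "g x \<in> carrier V" if "x \<in> carrier V" for x
    using that z d by (simp add: g_def)
  have hg: "h y (g x) = h y x \<ominus> h y z \<otimes> (d \<otimes> h z x)" if "x \<in> carrier V" "y \<in> carrier V" for x y
    using that z d by (simp add: g_def r_minus a_minus_def)
  have isom: "h (g x) (g y) = h x y" if x: "x \<in> carrier V" and y: "y \<in> carrier V" for x y
  proof -
    let ?p = "star (h z x)" and ?q = "h z y"
    have c: "?p \<in> carrier A" "?q \<in> carrier A" "h x y \<in> carrier A" "star d \<in> carrier A" "star e \<in> carrier A"
      using x y z d e by simp_all
    have hzgy: "h z (g y) = ?q \<ominus> (e \<oplus> star e) \<otimes> (d \<otimes> ?q)"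
      using hg[OF y z] hzz by simp
    have de: "star d \<otimes> star e = \<one>" using d e by (simp flip: star_mult)
    have "h (g x) (g y) = h x (g y) \<ominus> (?p \<otimes> star d) \<otimes> h z (g y)"
      using x y z d cl[OF y] unfolding g_def[of x] by (simp add: a_minus_def l_minus)
    also have "\<dots> = (h x y \<ominus> ?p \<otimes> (d \<otimes> ?q)) \<ominus> (?p \<otimes> star d) \<otimes> (?q \<ominus> (e \<oplus> star e) \<otimes> (d \<otimes> ?q))"
      using hg[OF y x] hzgy h_star[OF z x] by simp
    also have "\<dots> = (h x y \<ominus> ?p \<otimes> (d \<otimes> ?q)) \<ominus> ?p \<otimes> (star d \<otimes> ?q)
        \<oplus> ?p \<otimes> (star d \<otimes> ((e \<otimes> d) \<otimes> ?q)) \<oplus> ?p \<otimes> ((star d \<otimes> star e) \<otimes> (d \<otimes> ?q))"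
      using c d(1) e(2) by algebra
    also have "\<dots> = h x y"
      unfolding de d(2) using c d(1) e(2) by algebra
    finally show ?thesis .
  qed
  have "g \<in> isometries A V h V h"
  proof (rule isometriesI)
    fix x y assume xy: "x \<in> carrier V" "y \<in> carrier V"
    have "\<ominus> (d \<otimes> h z (x \<oplus>\<^bsub>V\<^esub> y)) = \<ominus> (d \<otimes> h z x) \<oplus> \<ominus> (d \<otimes> h z y)"
      using xy z d by (simp add: r_distr minus_add)
    then show "g (x \<oplus>\<^bsub>V\<^esub> y) = g x \<oplus>\<^bsub>V\<^esub> g y"
      using xy z d by (simp add: g_def smult_l_distr V.a_ac)
  next
    fix a x assume ax: "a \<in> carrier A" "x \<in> carrier V"
    have "\<ominus> (d \<otimes> h z (a \<odot>\<^bsub>V\<^esub> x)) = \<ominus> (d \<otimes> h z x) \<otimes> a"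
      using ax z d by (simp add: l_minus m_assoc)
    then show "g (a \<odot>\<^bsub>V\<^esub> x) = a \<odot>\<^bsub>V\<^esub> g x"
      using ax z d by (simp add: g_def smult_assoc smult_r_distr)
  qed (use cl isom in auto)
  moreover have "g v = w"
  proof -
    have "g v = v \<oplus>\<^bsub>V\<^esub> \<ominus>\<^bsub>V\<^esub> z"
      using d z by (simp add: g_def smult_minus_one flip: e_def)
    also have "\<dots> = w"
      using v w by (simp add: z_def a_minus_def V.minus_add V.r_neg2)
    finally show ?thesis .
  qed
  moreover have "g x = x" if "x \<in> carrier V" "h v x = \<zero>" "h w x = \<zero>" for x
  proof -
    have "h z x = \<zero>" using that v w by (simp add: z_def a_minus_def)
    then show ?thesis using that d z by (simp add: g_def)
  qed
  ultimately show ?thesis by blast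
qed

text \<open>Since \<open>h(v - w, v) + h(v + w, v) = 2 h(v, v)\<close> is a unit, one of the two summands is: either
  \<open>v\<close> can be reflected to \<open>w\<close>, or to \<open>-w\<close>, and \<open>-w\<close> can always be reflected to \<open>w\<close>.\<close>

lemma unit_length_transitive:
  assumes v: "v \<in> carrier V" and w: "w \<in> carrier V" and len: "h v v = h w w"
    and unit: "h v v \<in> Units A"
  shows "\<exists>g\<in>isometries A V h V h. g v = w \<and>
    (\<forall>x\<in>carrier V. h v x = \<zero> \<and> h w x = \<zero> \<longrightarrow> g x = x)"
proof (cases "h (v \<ominus>\<^bsub>V\<^esub> w) v \<in> Units A")
  case True
  then show ?thesis using reflection v w len by blast
next
  case False
  let ?m = "\<ominus>\<^bsub>V\<^esub> w"
  have m: "?m \<in> carrier V" using w by simp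
  have two: "l \<oplus> l \<in> Units A" if "l \<in> Units A" for l
  proof -
    have "l \<oplus> l = (\<one> \<oplus> \<one>) \<otimes> l" using Units_closed[OF that] by (simp add: l_distr)
    then show ?thesis using that two_Units by simp
  qed
  have "h (v \<ominus>\<^bsub>V\<^esub> w) v \<in> rad"
    using False nonunit_in_rad[of "h (v \<ominus>\<^bsub>V\<^esub> w) v"] v w by auto
  then have "(h v v \<oplus> h v v) \<oplus> \<ominus> h (v \<ominus>\<^bsub>V\<^esub> w) v \<in> Units A"
    using two[OF unit] Units_add_rad jacobson_radical_closed(4) by blast
  also have "(h v v \<oplus> h v v) \<oplus> \<ominus> h (v \<ominus>\<^bsub>V\<^esub> w) v = h (v \<ominus>\<^bsub>V\<^esub> ?m) v"
  proof -
    have c: "h v v \<in> carrier A" "h w v \<in> carrier A" using v w by auto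
    have "(h v v \<oplus> h v v) \<oplus> \<ominus> (h v v \<oplus> \<ominus> h w v) = h v v \<oplus> h w v" using c by algebra
    then show ?thesis using v w by (simp add: V.minus_eq)
  qed
  finally obtain g where g: "g \<in> isometries A V h V h" "g v = ?m"
      "\<And>x. x \<in> carrier V \<Longrightarrow> h v x = \<zero> \<Longrightarrow> h ?m x = \<zero> \<Longrightarrow> g x = x"
    using reflection[OF v m] len w by auto
  have "h (?m \<ominus>\<^bsub>V\<^esub> w) ?m = h w w \<oplus> h w w"
    using w by (simp add: V.minus_eq minus_add[symmetric])
  then have "h (?m \<ominus>\<^bsub>V\<^esub> w) ?m \<in> Units A" using two unit len by simp
  then obtain g' where g': "g' \<in> isometries A V h V h" "g' ?m = w"
      "\<And>x. x \<in> carrier V \<Longrightarrow> h ?m x = \<zero> \<Longrightarrow> h w x = \<zero> \<Longrightarrow> g' x = x"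
    using reflection[OF m w] w by auto
  show ?thesis
    using isometries_comp[OF g(1) g'(1)] g g' w
    by (intro bexI[of _ "\<lambda>x. g' (g x)"]) auto
qed

lemma orthogonal_pair_transitive:
  assumes xy: "x \<in> carrier V" "y \<in> carrier V" "h x x \<in> Units A" "h y y \<in> Units A" "h x y = \<zero>"
    and xy': "x' \<in> carrier V" "y' \<in> carrier V" "h x' x' = h x x" "h y' y' = h y y" "h x' y' = \<zero>"
  shows "\<exists>t\<in>isometries A V h V h. t x = x' \<and> t y = y'"
proof -
  obtain f where f: "f \<in> isometries A V h V h" "f x = x'"
    using unit_length_transitive[of x x'] xy xy' by auto
  have fy: "f y \<in> carrier V" "h (f y) (f y) = h y y" "h x' (f y) = \<zero>"
    using isometriesD[OF f(1)] xy f(2) by metis+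
  then obtain g where g: "g \<in> isometries A V h V h" "g (f y) = y'"
      "\<And>x. x \<in> carrier V \<Longrightarrow> h (f y) x = \<zero> \<Longrightarrow> h y' x = \<zero> \<Longrightarrow> g x = x"
    using unit_length_transitive[of "f y" y'] xy xy' by auto
  have "h (f y) x' = \<zero>" "h y' x' = \<zero>"
    using h_star[of x' "f y"] h_star[of x' y'] fy xy' by auto
  then have "g x' = x'" using g(3) xy' by blast
  then show ?thesis
    using isometries_comp[OF f(1) g(1)] f g by (intro bexI[of _ "\<lambda>x. g (f x)"]) auto
qed

end

section \<open>Splitting off a hyperbolic plane\<close>

context hermitian_space
begin

lemma module_mult_set_finsum:
  assumes "finite I" "c \<in> I \<rightarrow> J" "b \<in> I \<rightarrow> carrier V" "J \<subseteq> carrier A"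
  shows "(\<Oplus>\<^bsub>V\<^esub>i\<in>I. c i \<odot>\<^bsub>V\<^esub> b i) \<in> module_mult_set V J"
  using assms(1-3)
proof (induction I rule: finite_induct)
  case empty
  then show ?case
    using generate.one[of "add_monoid V"] by (simp add: module_mult_set_def)
next
  case (insert i I)
  then have i: "c i \<in> J" "b i \<in> carrier V" by auto
  have cl: "(\<lambda>i. c i \<odot>\<^bsub>V\<^esub> b i) \<in> I \<rightarrow> carrier V" "c i \<odot>\<^bsub>V\<^esub> b i \<in> carrier V"
    using insert.prems assms(4) by (auto simp: Pi_def subset_iff)
  have "c i \<odot>\<^bsub>V\<^esub> b i \<in> module_mult_set V J"
    unfolding module_mult_set_def using i by (intro generate.incl) blast
  moreover have "(\<Oplus>\<^bsub>V\<^esub>i\<in>I. c i \<odot>\<^bsub>V\<^esub> b i) \<in> module_mult_set V J"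
    using insert by auto
  ultimately have "c i \<odot>\<^bsub>V\<^esub> b i \<oplus>\<^bsub>V\<^esub> (\<Oplus>\<^bsub>V\<^esub>i\<in>I. c i \<odot>\<^bsub>V\<^esub> b i) \<in> module_mult_set V J"
    using generate.eng[of _ "add_monoid V"] by (simp add: module_mult_set_def)
  then show ?case using insert cl by (simp add: V.finsum_insert)
qed

lemma h_orthogonal_basis_coordinate:
  assumes b: "is_basis A V n b" and c: "\<And>i. i < n \<Longrightarrow> c i \<in> carrier A"
    and r: "\<And>i. i < n \<Longrightarrow> r i \<in> carrier A"
    and gram: "\<And>i j. i < n \<Longrightarrow> j < n \<Longrightarrow> h (b i) (b j) = (if i = j then r i else \<zero>)"
    and i: "i < n"
  shows "h (b i) (\<Oplus>\<^bsub>V\<^esub>j\<in>{..<n}. c j \<odot>\<^bsub>V\<^esub> b j) = r i \<otimes> c i"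
proof -
  note bi = basis_vector[OF b]
  have "h (b i) (\<Oplus>\<^bsub>V\<^esub>j\<in>{..<n}. c j \<odot>\<^bsub>V\<^esub> b j) = (\<Oplus>j\<in>{..<n}. h (b i) (c j \<odot>\<^bsub>V\<^esub> b j))"
    using bi c i by (intro additive_map_finsum V.abelian_group_axioms is_abelian_group) auto
  also have "\<dots> = (\<Oplus>j\<in>{..<n}. if i = j then r j \<otimes> c j else \<zero>)"
    using bi c i r by (intro finsum_cong') (auto simp: gram)
  also have "\<dots> = r i \<otimes> c i"
    using i c r by (intro finsum_singleton) auto
  finally show ?thesis .
qed

text \<open>Some coordinate of a primitive vector is a unit, and pairing with the corresponding vector of
  an orthogonal basis reads that coordinate off up to a unit.\<close>

lemma primitive_vector_pairs_to_one:
  assumes b: "is_basis A V n b"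
    and r: "\<And>i. i < n \<Longrightarrow> r i \<in> Units A"
    and gram: "\<And>i j. i < n \<Longrightarrow> j < n \<Longrightarrow> h (b i) (b j) = (if i = j then r i else \<zero>)"
    and u: "primitive_vector A V u"
  shows "\<exists>w\<in>carrier V. h u w = \<one>"
proof -
  have uc: "u \<in> carrier V" using u by (simp add: primitive_vector_def)
  then obtain c where c: "c \<in> {..<n} \<rightarrow>\<^sub>E carrier A" "u = (\<Oplus>\<^bsub>V\<^esub>i\<in>{..<n}. c i \<odot>\<^bsub>V\<^esub> b i)"
    using b unfolding is_basis_def by blast
  have "\<not> (\<forall>i<n. c i \<in> rad)"
  proof
    assume "\<forall>i<n. c i \<in> rad"
    then have "u \<in> module_mult_set V rad"
      unfolding c(2) using basis_vector[OF b] jacobson_radical_closed(1)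
      by (intro module_mult_set_finsum) auto
    with u show False by (simp add: primitive_vector_def)
  qed
  then obtain i where i: "i < n" "c i \<notin> rad" by blast
  have "c i \<in> Units A" using nonunit_in_rad[of "c i"] c(1) i by auto
  moreover have "h (b i) u = r i \<otimes> c i"
    unfolding c(2) using c(1) r i by (intro h_orthogonal_basis_coordinate[OF b _ _ gram]) auto
  ultimately have "h (b i) u \<in> Units A" using r[OF i(1)] by simp
  then have k: "h u (b i) \<in> Units A"
    using star_inv h_star[of "b i" u] basis_vector[OF b i(1)] uc by simp
  then have "h u (inv (h u (b i)) \<odot>\<^bsub>V\<^esub> b i) = \<one>"
    using basis_vector[OF b i(1)] uc by simp
  then show ?thesis
    using k basis_vector[OF b i(1)] by (intro bexI[of _ "inv (h u (b i)) \<odot>\<^bsub>V\<^esub> b i"]) auto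
qed

text \<open>Replacing \<open>w\<^sub>0\<close> by \<open>w\<^sub>0 - u x\<close> with \<open>x\<close> fixed changes its length to \<open>s - (2x - r x\<^sup>2)\<close>, where
  \<open>s\<close> and \<open>r\<close> are the lengths of \<open>w\<^sub>0\<close> and \<open>u\<close>, and \<open>2x - r x\<^sup>2\<close> takes every fixed value.\<close>

lemma isotropic_partner:
  assumes u: "u \<in> carrier V" and r: "h u u \<in> rad" and w: "w \<in> carrier V" "h u w = \<one>"
  shows "\<exists>w\<in>carrier V. h u w = \<one> \<and> h w w = \<zero>"
proof -
  let ?r = "h u u" and ?s = "h w w"
  have "?s \<in> (\<lambda>x. x \<oplus> x \<ominus> ?r \<otimes> (x \<otimes> x)) ` Fix"
    using bij_betw_imp_surj_on[OF fixed_quadratic_bij[OF length_fixed[OF u] r]] length_fixed[OF w(1)]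
    by simp
  then obtain x where x: "x \<in> Fix" "?s = x \<oplus> x \<ominus> ?r \<otimes> (x \<otimes> x)" by blast
  have c: "x \<in> carrier A" "?r \<in> carrier A" "star x = x"
    using x u fixed_carrier fixed_star by auto
  have com: "x \<otimes> ?r = ?r \<otimes> x" using fixed_comm[OF x(1) c(2)] by simp
  have wu: "h w u = \<one>" using h_star[OF u w(1)] w by simp
  let ?w = "w \<oplus>\<^bsub>V\<^esub> (\<ominus> x) \<odot>\<^bsub>V\<^esub> u"
  have wc: "?w \<in> carrier V" using u w c by simp
  have "h ?w ?w = (x \<oplus> x \<ominus> ?r \<otimes> (x \<otimes> x)) \<oplus> (\<ominus> x) \<oplus> (\<one> \<oplus> (\<ominus> x) \<otimes> ?r) \<otimes> (\<ominus> x)"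
    using u w c wu by (simp add: x(2) a_ac)
  also have "\<dots> = (x \<otimes> ?r) \<otimes> x \<ominus> ?r \<otimes> (x \<otimes> x)"
    using c(1,2) by algebra
  also have "\<dots> = \<zero>" unfolding com using c(1,2) by algebra
  finally have len: "h ?w ?w = \<zero>" .
  let ?k = "\<one> \<oplus> ?r \<otimes> (\<ominus> x)"
  have k: "?k \<in> Units A"
    using Units_add_rad[OF Units_one_closed jacobson_radical_closed(5)[OF r, of "\<ominus> x"]] c by simp
  have huw: "h u ?w = ?k" using u w c by simp
  let ?w' = "inv ?k \<odot>\<^bsub>V\<^esub> ?w"
  have "h u ?w' = \<one>" using u wc k huw by simp
  moreover have "h ?w' ?w' = \<zero>" using wc k len by simp
  moreover have "?w' \<in> carrier V" using wc k by simp
  ultimately show ?thesis by blast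
qed

abbreviation perp :: "'v \<Rightarrow> 'v \<Rightarrow> 'v set" where
  "perp u w \<equiv> {v \<in> carrier V. h u v = \<zero> \<and> h w v = \<zero>}"

text \<open>Send the \<open>i\<close>-th basis vector of \<open>V'\<close> to the vector with index \<open>i + 2\<close> in the basis of \<open>V\<close>; the
  Gram matrices match, and orthogonality makes the image the complement of the two vectors that are
  left out.\<close>

lemma diagonal_embedding:
  fixes V' :: "('a, 'w, 't) module_scheme"
  assumes S: "hermitian_space A star V' h'"
    and b: "is_basis A V (Suc (Suc n)) b" and b': "is_basis A V' n b'"
    and r: "r 0 \<in> Units A" "r 1 \<in> Units A"
    and gram: "\<And>i j. i < Suc (Suc n) \<Longrightarrow> j < Suc (Suc n) \<Longrightarrow> h (b i) (b j) = (if i = j then r i else \<zero>)"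
    and gram': "\<And>i j. i < n \<Longrightarrow> j < n \<Longrightarrow> h' (b' i) (b' j) = (if i = j then r (Suc (Suc i)) else \<zero>)"
  shows "\<exists>\<phi>\<in>isometries A V' h' V h. \<phi> ` carrier V' = perp (b 0) (b 1)"
proof -
  interpret S: hermitian_space A star V' h' by fact
  have mV: "right_module A V" "right_module A V'" by unfold_locales
  note bc = basis_vector[OF b] and bc' = S.basis_vector[OF b']
  obtain \<phi> where hom: "\<phi> \<in> right_module_hom A V' V" and \<phi>b: "\<And>i. i < n \<Longrightarrow> \<phi> (b' i) = b (Suc (Suc i))"
    using basis_linear_extension[OF mV(2,1) b', of "\<lambda>i. b (Suc (Suc i))"] bc by auto
  have \<phi>: "\<And>v. v \<in> carrier V' \<Longrightarrow> \<phi> v \<in> carrier V"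
    "\<And>v w. v \<in> carrier V' \<Longrightarrow> w \<in> carrier V' \<Longrightarrow> \<phi> (v \<oplus>\<^bsub>V'\<^esub> w) = \<phi> v \<oplus>\<^bsub>V\<^esub> \<phi> w"
    "\<And>a v. a \<in> carrier A \<Longrightarrow> v \<in> carrier V' \<Longrightarrow> \<phi> (a \<odot>\<^bsub>V'\<^esub> v) = a \<odot>\<^bsub>V\<^esub> \<phi> v"
    using hom by (auto simp: right_module_hom_def)
  have \<phi>0: "\<phi> \<zero>\<^bsub>V'\<^esub> = \<zero>\<^bsub>V\<^esub>"
    using \<phi>(3)[of \<zero> "\<zero>\<^bsub>V'\<^esub>"] \<phi>(1) by simp
  have isob: "h (b (Suc (Suc i))) (\<phi> y) = h' (b' i) y" if i: "i < n" and y: "y \<in> carrier V'" for i y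
    using b' y
  proof (induction y rule: S.basis_induct)
    case (basis j)
    then show ?case using i gram[of "Suc (Suc i)" "Suc (Suc j)"] gram'[of i j] \<phi>b by simp
  qed (use i bc bc' \<phi> \<phi>0 in simp_all)
  have iso: "h (\<phi> x) (\<phi> y) = h' x y" if x: "x \<in> carrier V'" and y: "y \<in> carrier V'" for x y
    using b' x
  proof (induction x rule: S.basis_induct)
    case (basis j)
    then show ?case using isob y \<phi>b by simp
  qed (use y \<phi> \<phi>0 in simp_all)
  have orth: "h (b k) (\<phi> y) = \<zero>" if k: "k < 2" and y: "y \<in> carrier V'" for k y
    using b' y
  proof (induction y rule: S.basis_induct)
    case (basis j)
    then show ?case using k gram[of k "Suc (Suc j)"] \<phi>b by simp
  qed (use k bc \<phi> \<phi>0 in simp_all)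
  have iso\<phi>: "\<phi> \<in> isometries A V' h' V h"
    using \<phi> iso by (intro isometriesI) simp_all
  have b01: "b 0 \<in> carrier V" "b 1 \<in> carrier V" using bc by simp_all
  have dec: "\<exists>a\<in>carrier A. \<exists>c\<in>carrier A. \<exists>z\<in>carrier V'. v = a \<odot>\<^bsub>V\<^esub> b 0 \<oplus>\<^bsub>V\<^esub> c \<odot>\<^bsub>V\<^esub> b 1 \<oplus>\<^bsub>V\<^esub> \<phi> z"
    if "v \<in> carrier V" for v
    using b that
  proof (induction v rule: basis_induct)
    case zero
    show ?case
      using b01 \<phi>0 by (intro bexI[of _ \<zero>] bexI[of _ "\<zero>\<^bsub>V'\<^esub>"]) simp_all
  next
    case (basis i)
    consider "i = 0" | "i = 1" | j where "i = Suc (Suc j)" by (metis One_nat_def old.nat.exhaust)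
    then show ?case
    proof cases
      case 1
      then show ?thesis
        using b01 \<phi>0 smult_one by (intro bexI[of _ \<one>] bexI[of _ \<zero>] bexI[of _ "\<zero>\<^bsub>V'\<^esub>"]) simp_all
    next
      case 2
      show ?thesis unfolding 2
        using b01 \<phi>0 smult_one by (intro bexI[of _ \<zero>] bexI[of _ \<one>] bexI[of _ "\<zero>\<^bsub>V'\<^esub>"]) simp_all
    next
      case 3
      then show ?thesis
        using b01 \<phi>b[of j] bc' basis bc by (intro bexI[of _ \<zero>] bexI[of _ "b' j"]) simp_all
    qed
  next
    case (add v w)
    then obtain a c z a' c' z' where *: "a \<in> carrier A" "c \<in> carrier A" "z \<in> carrier V'"
        "v = a \<odot>\<^bsub>V\<^esub> b 0 \<oplus>\<^bsub>V\<^esub> c \<odot>\<^bsub>V\<^esub> b 1 \<oplus>\<^bsub>V\<^esub> \<phi> z"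
        "a' \<in> carrier A" "c' \<in> carrier A" "z' \<in> carrier V'"
        "w = a' \<odot>\<^bsub>V\<^esub> b 0 \<oplus>\<^bsub>V\<^esub> c' \<odot>\<^bsub>V\<^esub> b 1 \<oplus>\<^bsub>V\<^esub> \<phi> z'"
      by blast
    then show ?case
      using b01 \<phi>
      by (intro bexI[of _ "a \<oplus> a'"] bexI[of _ "c \<oplus> c'"] bexI[of _ "z \<oplus>\<^bsub>V'\<^esub> z'"])
         (simp_all add: smult_l_distr V.a_ac)
  next
    case (smult d v)
    then obtain a c z where *: "a \<in> carrier A" "c \<in> carrier A" "z \<in> carrier V'"
        "v = a \<odot>\<^bsub>V\<^esub> b 0 \<oplus>\<^bsub>V\<^esub> c \<odot>\<^bsub>V\<^esub> b 1 \<oplus>\<^bsub>V\<^esub> \<phi> z"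
      by blast
    then show ?case
      using b01 \<phi> smult(1)
      by (intro bexI[of _ "a \<otimes> d"] bexI[of _ "c \<otimes> d"] bexI[of _ "d \<odot>\<^bsub>V'\<^esub> z"])
         (simp_all add: smult_r_distr smult_assoc)
  qed
  have "\<phi> ` carrier V' = perp (b 0) (b 1)"
  proof (intro equalityI subsetI)
    fix v assume "v \<in> \<phi> ` carrier V'"
    then show "v \<in> perp (b 0) (b 1)" using \<phi>(1) orth by auto
  next
    fix v assume v: "v \<in> perp (b 0) (b 1)"
    then obtain a c z where *: "a \<in> carrier A" "c \<in> carrier A" "z \<in> carrier V'"
        "v = a \<odot>\<^bsub>V\<^esub> b 0 \<oplus>\<^bsub>V\<^esub> c \<odot>\<^bsub>V\<^esub> b 1 \<oplus>\<^bsub>V\<^esub> \<phi> z"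
      using dec by blast
    have "h (b 0) v = r 0 \<otimes> a" "h (b 1) v = r 1 \<otimes> c"
      using * b01 \<phi>(1) orth gram[of 0 0] gram[of 0 1] gram[of 1 0] gram[of 1 1] r[THEN Units_closed]
      by simp_all
    then have "r 0 \<otimes> a = \<zero>" "r 1 \<otimes> c = \<zero>" using v by simp_all
    then have "a = \<zero>" "c = \<zero>"
      using Units_l_cancel[OF r(1), of a \<zero>] Units_l_cancel[OF r(2), of c \<zero>] r[THEN Units_closed] *
      by simp_all
    then have "v = \<phi> z" using * b01 \<phi>(1) by simp
    then show "v \<in> \<phi> ` carrier V'" using *(3) by blast
  qed
  with iso\<phi> show ?thesis by blast
qed

text \<open>With \<open>2\<alpha> = 1 - h(u, u)\<close> the vectors \<open>x = u + w\<alpha>\<close> and \<open>y = x - w\<close> are orthogonal of lengths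
  \<open>1\<close> and \<open>-1\<close>, and they have the same orthogonal complement as \<open>u\<close> and \<open>w\<close>.  All such pairs
  \<open>(x, y)\<close> are conjugate under isometries, hence so are the complements.\<close>

lemma hyperbolic_complement:
  assumes xy: "x\<^sub>0 \<in> carrier V" "y\<^sub>0 \<in> carrier V" "h x\<^sub>0 x\<^sub>0 = \<one>" "h y\<^sub>0 y\<^sub>0 = \<ominus> \<one>" "h x\<^sub>0 y\<^sub>0 = \<zero>"
    and \<phi>: "\<phi> \<in> isometries A V' h' V h" "\<phi> ` carrier V' = perp x\<^sub>0 y\<^sub>0"
    and uw: "u \<in> carrier V" "w \<in> carrier V" "h u w = \<one>" "h w w = \<zero>"
  shows "\<exists>\<psi>\<in>isometries A V' h' V h. \<psi> ` carrier V' = perp u w"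
proof -
  let ?r = "h u u"
  define \<alpha> where "\<alpha> = half \<otimes> (\<one> \<ominus> ?r)"
  have rF: "\<one> \<ominus> ?r \<in> Fix"
    using length_fixed[OF uw(1)] fixed_minus_closed by (simp add: a_minus_def)
  then have \<alpha>F: "\<alpha> \<in> Fix" using half_fixed by (simp add: \<alpha>_def)
  have c: "\<alpha> \<in> carrier A" "?r \<in> carrier A" "star \<alpha> = \<alpha>"
    using \<alpha>F fixed_carrier fixed_star uw by auto
  have \<alpha>2: "\<alpha> \<oplus> \<alpha> = \<one> \<ominus> ?r" unfolding \<alpha>_def using half_double rF fixed_carrier by blast
  have wu: "h w u = \<one>" using h_star[OF uw(1,2)] uw by simp
  define x where "x = u \<oplus>\<^bsub>V\<^esub> \<alpha> \<odot>\<^bsub>V\<^esub> w"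
  define y where "y = x \<oplus>\<^bsub>V\<^esub> (\<ominus>\<^bsub>V\<^esub> w)"
  have cx: "x \<in> carrier V" "y \<in> carrier V" using uw c by (simp_all add: x_def y_def)
  have hx: "h x w = \<one>" "h w x = \<one>" using uw c wu by (simp_all add: x_def)
  have xx: "h x x = \<one>"
  proof -
    have "h x x = ?r \<oplus> (\<alpha> \<oplus> \<alpha>)" using uw c wu by (simp add: x_def a_ac)
    also have "\<dots> = \<one>" unfolding \<alpha>2 using c(2) by algebra
    finally show ?thesis .
  qed
  have xy': "h x y = \<zero>" using cx uw xx hx by (simp add: y_def r_neg)
  have yy: "h y y = \<ominus> \<one>"
    using cx uw xx hx unfolding y_def by (simp add: r_neg)
  have perp: "perp x y = perp u w"
  proof -
    have "h x v = h u v \<oplus> \<alpha> \<otimes> h w v" "h y v = h x v \<ominus> h w v" if "v \<in> carrier V" for v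
      using that uw c cx by (simp_all add: x_def y_def a_minus_def)
    then have "h x v = \<zero> \<and> h y v = \<zero> \<longleftrightarrow> h u v = \<zero> \<and> h w v = \<zero>" if "v \<in> carrier V" for v
      using that uw c cx by (auto simp: a_minus_def)
    then show ?thesis by blast
  qed
  have "\<ominus> \<one> \<in> Units A"
    unfolding Units_def by (auto intro!: bexI[of _ "\<ominus> \<one>"] simp: l_minus r_minus)
  then obtain t where t: "t \<in> isometries A V h V h" "t x\<^sub>0 = x" "t y\<^sub>0 = y"
    using orthogonal_pair_transitive[of x\<^sub>0 y\<^sub>0 x y] xy cx xx yy xy' by auto
  have "(\<lambda>z. t (\<phi> z)) ` carrier V' = perp x y"
  proof -
    have "t ` perp x\<^sub>0 y\<^sub>0 = perp x y"
    proof (intro equalityI subsetI)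
      fix v assume "v \<in> t ` perp x\<^sub>0 y\<^sub>0"
      then obtain v\<^sub>0 where v\<^sub>0: "v = t v\<^sub>0" "v\<^sub>0 \<in> perp x\<^sub>0 y\<^sub>0" by blast
      then show "v \<in> perp x y"
        using isometriesD(1)[OF t(1), of v\<^sub>0] isometriesD(4)[OF t(1) xy(1), of v\<^sub>0]
          isometriesD(4)[OF t(1) xy(2), of v\<^sub>0] t(2,3) by simp
    next
      fix v assume v: "v \<in> perp x y"
      then have "v \<in> t ` carrier V" using isometry_bij_betw[OF t(1)] by (simp add: bij_betw_def)
      then obtain v\<^sub>0 where v\<^sub>0: "v = t v\<^sub>0" "v\<^sub>0 \<in> carrier V" by blast
      then have "v\<^sub>0 \<in> perp x\<^sub>0 y\<^sub>0"
        using isometriesD(4)[OF t(1) xy(1), of v\<^sub>0] isometriesD(4)[OF t(1) xy(2), of v\<^sub>0] t(2,3) v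
        by simp
      then show "v \<in> t ` perp x\<^sub>0 y\<^sub>0" using v\<^sub>0 by blast
    qed
    then show ?thesis unfolding \<phi>(2)[symmetric] image_image .
  qed
  then have "(\<lambda>z. t (\<phi> z)) ` carrier V' = perp u w" unfolding perp .
  then show ?thesis by (rule bexI[OF _ isometries_comp[OF \<phi>(1) t(1)]])
qed

end

section \<open>Counting the stabilizer\<close>

text \<open>The map \<open>\<psi>\<close> identifies \<open>V'\<close> with the complement of the plane spanned by \<open>u\<close> and \<open>w\<close>.  While \<open>V\<close>
  and \<open>u\<close> stay the same, \<open>w\<close> and \<open>\<psi>\<close> will vary: an isometry fixing \<open>u\<close> is a passage from one such
  splitting to another.\<close>

locale split_space = hermitian_space A star V h + S: hermitian_space A star V' h'
  for A :: "('a, 'r) ring_scheme" (structure) and star :: "'a \<Rightarrow> 'a"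
    and V :: "('a, 'v, 's) module_scheme" and h :: "'v \<Rightarrow> 'v \<Rightarrow> 'a"
    and V' :: "('a, 'w, 't) module_scheme" and h' :: "'w \<Rightarrow> 'w \<Rightarrow> 'a" +
  fixes u w :: 'v and \<psi> :: "'w \<Rightarrow> 'v"
  assumes u: "u \<in> carrier V" and w: "w \<in> carrier V" and huw: "h u w = \<one>" and hww: "h w w = \<zero>"
    and \<psi>: "\<psi> \<in> isometries A V' h' V h" and \<psi>_image: "\<psi> ` carrier V' = perp u w"
begin

definition assemble :: "'a \<Rightarrow> 'a \<Rightarrow> 'w \<Rightarrow> 'v" where
  "assemble a b z = a \<odot>\<^bsub>V\<^esub> u \<oplus>\<^bsub>V\<^esub> b \<odot>\<^bsub>V\<^esub> w \<oplus>\<^bsub>V\<^esub> \<psi> z"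

lemma hwu: "h w u = \<one>"
  using h_star[OF u w] huw by simp

lemma \<psi>_perp:
  assumes "z \<in> carrier V'"
  shows "\<psi> z \<in> carrier V" "h u (\<psi> z) = \<zero>" "h w (\<psi> z) = \<zero>" "h (\<psi> z) u = \<zero>" "h (\<psi> z) w = \<zero>"
proof -
  have "\<psi> z \<in> perp u w" using assms \<psi>_image by blast
  then show *: "\<psi> z \<in> carrier V" "h u (\<psi> z) = \<zero>" "h w (\<psi> z) = \<zero>" by simp_all
  show "h (\<psi> z) u = \<zero>" "h (\<psi> z) w = \<zero>"
    using h_star[OF u *(1)] h_star[OF w *(1)] * by simp_all
qed

lemma \<psi>_inj: "z \<in> carrier V' \<Longrightarrow> z' \<in> carrier V' \<Longrightarrow> \<psi> z = \<psi> z' \<Longrightarrow> z = z'"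
  using S.isometry_inj_on[OF \<psi>] by (auto dest: inj_onD)

lemma \<psi>_zero: "\<psi> \<zero>\<^bsub>V'\<^esub> = \<zero>\<^bsub>V\<^esub>"
  using isometriesD(3)[OF \<psi>, of \<zero> "\<zero>\<^bsub>V'\<^esub>"] \<psi>_perp(1)[of "\<zero>\<^bsub>V'\<^esub>"] by simp

lemma assemble_closed:
  "a \<in> carrier A \<Longrightarrow> b \<in> carrier A \<Longrightarrow> z \<in> carrier V' \<Longrightarrow> assemble a b z \<in> carrier V"
  using u w \<psi>_perp by (simp add: assemble_def)

lemma h_assemble:
  assumes "a \<in> carrier A" "b \<in> carrier A" "z \<in> carrier V'"
  shows "h w (assemble a b z) = a" "h u (assemble a b z) = h u u \<otimes> a \<oplus> b"
  using assms u w huw hww hwu \<psi>_perp[OF assms(3)] by (simp_all add: assemble_def)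

lemma h_assemble_assemble:
  assumes "a \<in> carrier A" "b \<in> carrier A" "z \<in> carrier V'"
    and "a' \<in> carrier A" "b' \<in> carrier A" "z' \<in> carrier V'"
  shows "h (assemble a b z) (assemble a' b' z') =
    star a \<otimes> (h u u \<otimes> a' \<oplus> b') \<oplus> star b \<otimes> a' \<oplus> h' z z'"
proof -
  have "h (assemble a b z) (assemble a' b' z') =
      star a \<otimes> h u (assemble a' b' z') \<oplus> star b \<otimes> h w (assemble a' b' z') \<oplus> h (\<psi> z) (assemble a' b' z')"
    using assms u w \<psi>_perp assemble_closed unfolding assemble_def[of a b z] by simp
  moreover have "h (\<psi> z) (assemble a' b' z') = h' z z'"
    using assms u w \<psi>_perp[OF assms(3)] \<psi>_perp[OF assms(6)] isometriesD(4)[OF \<psi>]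
    by (simp add: assemble_def)
  ultimately show ?thesis using h_assemble assms by simp
qed

lemma assemble_add:
  assumes "a \<in> carrier A" "b \<in> carrier A" "z \<in> carrier V'"
    and "a' \<in> carrier A" "b' \<in> carrier A" "z' \<in> carrier V'"
  shows "assemble a b z \<oplus>\<^bsub>V\<^esub> assemble a' b' z' = assemble (a \<oplus> a') (b \<oplus> b') (z \<oplus>\<^bsub>V'\<^esub> z')"
  using assms u w \<psi>_perp(1) isometriesD(2)[OF \<psi>]
  by (simp add: assemble_def smult_l_distr V.a_ac)

lemma assemble_smult:
  assumes "a \<in> carrier A" "b \<in> carrier A" "z \<in> carrier V'" "c \<in> carrier A"
  shows "c \<odot>\<^bsub>V\<^esub> assemble a b z = assemble (a \<otimes> c) (b \<otimes> c) (c \<odot>\<^bsub>V'\<^esub> z)"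
  using assms u w \<psi>_perp(1) isometriesD(3)[OF \<psi>]
  by (simp add: assemble_def smult_r_distr smult_assoc)

lemma assemble_inj:
  assumes "a \<in> carrier A" "b \<in> carrier A" "z \<in> carrier V'"
    and "a' \<in> carrier A" "b' \<in> carrier A" "z' \<in> carrier V'"
    and eq: "assemble a b z = assemble a' b' z'"
  shows "a = a' \<and> b = b' \<and> z = z'"
proof -
  have a: "a = a'" using h_assemble(1) assms by metis
  have "h u u \<otimes> a \<oplus> b = h u u \<otimes> a' \<oplus> b'" using h_assemble(2) assms by metis
  then have b: "b = b'" using a assms u by simp
  have "\<psi> z = \<psi> z'" using eq a b assms u w \<psi>_perp(1) by (simp add: assemble_def)
  then show ?thesis using \<psi>_inj assms a b by blast
qed

lemma assemble_surj:
  assumes v: "v \<in> carrier V"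
  shows "\<exists>a\<in>carrier A. \<exists>b\<in>carrier A. \<exists>z\<in>carrier V'. v = assemble a b z"
proof -
  let ?a = "h w v" and ?b = "h u v \<ominus> h u u \<otimes> h w v"
  have c: "?a \<in> carrier A" "?b \<in> carrier A" "h u u \<in> carrier A" "h u v \<in> carrier A" using v u w by simp_all
  let ?p = "?a \<odot>\<^bsub>V\<^esub> u \<oplus>\<^bsub>V\<^esub> ?b \<odot>\<^bsub>V\<^esub> w"
  have p: "?p \<in> carrier V" using c u w by simp
  have "h u ?p = h u u \<otimes> ?a \<oplus> ?b" using c u w huw by simp
  also have "\<dots> = h u v" using c by algebra
  finally have hup: "h u ?p = h u v" .
  have hwp: "h w ?p = h w v" using c u w hwu hww by simp
  have "h u (v \<ominus>\<^bsub>V\<^esub> ?p) = h u v \<oplus> \<ominus> h u ?p" "h w (v \<ominus>\<^bsub>V\<^esub> ?p) = h w v \<oplus> \<ominus> h w ?p"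
    using v u w p by (simp_all only: a_minus_def h_add_right h_minus V.a_inv_closed)
  then have "v \<ominus>\<^bsub>V\<^esub> ?p \<in> perp u w" using v u w p c hup hwp by (simp add: r_neg)
  then obtain z where z: "z \<in> carrier V'" "v \<ominus>\<^bsub>V\<^esub> ?p = \<psi> z" using \<psi>_image by blast
  have "x \<oplus>\<^bsub>V\<^esub> (v \<ominus>\<^bsub>V\<^esub> x) = v" if "x \<in> carrier V" for x
    using that v by (simp add: a_minus_def V.a_lcomm[of x v] V.r_neg)
  from this[OF p, symmetric] have "v = assemble ?a ?b z" unfolding z(2) assemble_def .
  then show ?thesis using c z(1) by blast
qed

definition coordinates :: "'v \<Rightarrow> 'a \<times> 'a \<times> 'w" where
  "coordinates v = (THE t. fst t \<in> carrier A \<and> fst (snd t) \<in> carrier A \<and> snd (snd t) \<in> carrier V' \<and>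
     v = assemble (fst t) (fst (snd t)) (snd (snd t)))"

lemma coordinates_assemble:
  "a \<in> carrier A \<Longrightarrow> b \<in> carrier A \<Longrightarrow> z \<in> carrier V' \<Longrightarrow> coordinates (assemble a b z) = (a, b, z)"
  unfolding coordinates_def using assemble_inj by (intro the_equality) (auto simp: prod_eq_iff)

lemma assemble_u: "assemble \<one> \<zero> \<zero>\<^bsub>V'\<^esub> = u"
  and assemble_w: "assemble \<zero> \<one> \<zero>\<^bsub>V'\<^esub> = w"
  and assemble_\<psi>: "z \<in> carrier V' \<Longrightarrow> assemble \<zero> \<zero> z = \<psi> z"
  using u w \<psi>_zero smult_one \<psi>_perp(1) by (simp_all add: assemble_def)

text \<open>Completing \<open>u\<close> to a pair with the Gram matrix of \<open>(u, w)\<close> amounts to solving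
  \<open>a + a\<^sup>* - h(u, u) a\<^sup>* a = - h'(z, z)\<close> for a scalar \<open>a\<close> and a vector \<open>z\<close> of the complement: the
  condition \<open>h(u, x) = 1\<close> forces the coefficient of \<open>w\<close> to be \<open>1 - h(u, u) a\<close>.\<close>

lemma card_isotropic_partners:
  assumes r: "h u u \<in> rad"
  shows "card {x \<in> carrier V. h u x = \<one> \<and> h x x = \<zero>} = card (carrier V') * card Skew"
proof -
  let ?r = "h u u"
  define Q where "Q z = {a \<in> carrier A. a \<oplus> star a \<ominus> ?r \<otimes> (star a \<otimes> a) = \<ominus> h' z z}" for z
  define F where "F = (\<lambda>(z, a). assemble a (\<one> \<ominus> ?r \<otimes> a) z)"
  have rc: "?r \<in> carrier A" "star ?r = ?r" using u length_fixed[OF u] fixed_star by auto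
  have len: "h (assemble a (\<one> \<ominus> ?r \<otimes> a) z) (assemble a (\<one> \<ominus> ?r \<otimes> a) z)
      = (a \<oplus> star a \<ominus> ?r \<otimes> (star a \<otimes> a)) \<oplus> h' z z"
    if "a \<in> carrier A" "z \<in> carrier V'" for a z
  proof -
    have sb: "star (\<one> \<ominus> ?r \<otimes> a) = \<one> \<ominus> star a \<otimes> ?r"
      using that rc by (simp add: a_minus_def)
    have com: "star a \<otimes> ?r = ?r \<otimes> star a" using fixed_comm[OF length_fixed[OF u]] that by simp
    have c: "a \<in> carrier A" "star a \<in> carrier A" "?r \<in> carrier A" "h' z z \<in> carrier A"
      using that rc by simp_all
    have "h (assemble a (\<one> \<ominus> ?r \<otimes> a) z) (assemble a (\<one> \<ominus> ?r \<otimes> a) z)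
        = star a \<otimes> (?r \<otimes> a \<oplus> (\<one> \<ominus> ?r \<otimes> a)) \<oplus> (\<one> \<ominus> star a \<otimes> ?r) \<otimes> a \<oplus> h' z z"
      using that rc by (subst h_assemble_assemble) (simp_all add: sb)
    also have "\<dots> = (a \<oplus> star a \<ominus> ?r \<otimes> (star a \<otimes> a)) \<oplus> h' z z"
      unfolding com using c r_one[OF c(2)] by algebra
    finally show ?thesis .
  qed
  have hu: "h u (assemble a (\<one> \<ominus> ?r \<otimes> a) z) = \<one>" if "a \<in> carrier A" "z \<in> carrier V'" for a z
  proof -
    have "h u (assemble a (\<one> \<ominus> ?r \<otimes> a) z) = ?r \<otimes> a \<oplus> (\<one> \<ominus> ?r \<otimes> a)"
      using that rc by (subst h_assemble) simp_all
    also have "\<dots> = \<one>" using that rc(1) by algebra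
    finally show ?thesis .
  qed
  have "bij_betw F (Sigma (carrier V') Q) {x \<in> carrier V. h u x = \<one> \<and> h x x = \<zero>}"
  proof (rule bij_betw_imageI)
    show "inj_on F (Sigma (carrier V') Q)"
    proof (rule inj_onI)
      fix p q assume p: "p \<in> Sigma (carrier V') Q" and q: "q \<in> Sigma (carrier V') Q" and eq: "F p = F q"
      obtain z a z' a' where pq: "p = (z, a)" "q = (z', a')" by (cases p, cases q)
      have "a = a' \<and> (\<one> \<ominus> ?r \<otimes> a) = (\<one> \<ominus> ?r \<otimes> a') \<and> z = z'"
        using p q eq rc(1) by (intro assemble_inj) (auto simp: pq F_def Q_def)
      then show "p = q" by (simp add: pq)
    qed
    show "F ` Sigma (carrier V') Q = {x \<in> carrier V. h u x = \<one> \<and> h x x = \<zero>}"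
    proof (intro equalityI subsetI)
      fix x assume "x \<in> F ` Sigma (carrier V') Q"
      then obtain z a where *: "z \<in> carrier V'" "a \<in> Q z" "x = assemble a (\<one> \<ominus> ?r \<otimes> a) z"
        by (auto simp: F_def)
      have a: "a \<in> carrier A" "a \<oplus> star a \<ominus> ?r \<otimes> (star a \<otimes> a) = \<ominus> h' z z" using * by (simp_all add: Q_def)
      have "h x x = \<zero>" using len[OF a(1) *(1)] a(2) *(1) by (simp add: *(3) l_neg)
      then show "x \<in> {x \<in> carrier V. h u x = \<one> \<and> h x x = \<zero>}"
        using hu[OF a(1) *(1)] assemble_closed[OF a(1) _ *(1)] a(1) rc by (simp add: *(3))
    next
      fix x assume x: "x \<in> {x \<in> carrier V. h u x = \<one> \<and> h x x = \<zero>}"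
      then obtain a b z where *: "a \<in> carrier A" "b \<in> carrier A" "z \<in> carrier V'" "x = assemble a b z"
        using assemble_surj by blast
      have "?r \<otimes> a \<oplus> b = \<one>" using x h_assemble(2)[OF *(1-3)] *(4) by simp
      moreover have "b = (?r \<otimes> a \<oplus> b) \<ominus> ?r \<otimes> a" using *(1,2) rc(1) by algebra
      ultimately have b: "b = \<one> \<ominus> ?r \<otimes> a" by simp
      have "(a \<oplus> star a \<ominus> ?r \<otimes> (star a \<otimes> a)) \<oplus> h' z z = \<zero>"
        using x len[OF *(1,3)] *(4) b by simp
      then have "a \<oplus> star a \<ominus> ?r \<otimes> (star a \<otimes> a) = \<ominus> h' z z"
        using * rc by (intro minus_equality[symmetric]) simp_all
      then have "(z, a) \<in> Sigma (carrier V') Q" using * by (simp add: Q_def)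
      moreover have "x = F (z, a)" using *(4) b by (simp add: F_def)
      ultimately show "x \<in> F ` Sigma (carrier V') Q" by blast
    qed
  qed
  then have "card {x \<in> carrier V. h u x = \<one> \<and> h x x = \<zero>} = card (Sigma (carrier V') Q)"
    by (simp add: bij_betw_same_card)
  also have "\<dots> = (\<Sum>z\<in>carrier V'. card (Q z))"
    using S.finite_vectors finite_carrier by (intro card_SigmaI) (auto simp: Q_def)
  also have "\<dots> = (\<Sum>z\<in>carrier V'. card Skew)"
  proof (rule sum.cong[OF refl])
    fix z assume "z \<in> carrier V'"
    then show "card (Q z) = card Skew"
      unfolding Q_def
      using card_hermitian_quadratic_solutions[OF length_fixed[OF u] r] fixed_minus_closed S.length_fixed
      by blast
  qed
  finally show ?thesis by simp
qed

lemma isometry_on_assemble: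
  assumes f: "f \<in> isometries A V h V h" and "a \<in> carrier A" "b \<in> carrier A" "z \<in> carrier V'"
  shows "f (assemble a b z) = a \<odot>\<^bsub>V\<^esub> f u \<oplus>\<^bsub>V\<^esub> b \<odot>\<^bsub>V\<^esub> f w \<oplus>\<^bsub>V\<^esub> f (\<psi> z)"
  using assms(2-) u w \<psi>_perp(1) isometriesD[OF f] by (simp add: assemble_def)

lemma isometry_extensional_eqI:
  assumes f: "f \<in> isometries A V h V h" "f \<in> extensional (carrier V)"
    and g: "g \<in> isometries A V h V h" "g \<in> extensional (carrier V)"
    and eq: "f u = g u" "f w = g w" "\<And>z. z \<in> carrier V' \<Longrightarrow> f (\<psi> z) = g (\<psi> z)"
  shows "f = g"
proof (rule extensionalityI[OF f(2) g(2)])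
  fix v assume "v \<in> carrier V"
  then obtain a b z where "a \<in> carrier A" "b \<in> carrier A" "z \<in> carrier V'" "v = assemble a b z"
    using assemble_surj by blast
  then show "f v = g v" using isometry_on_assemble[OF f(1)] isometry_on_assemble[OF g(1)] eq by simp
qed

text \<open>Inner products of assembled vectors do not involve the second vector of the pair nor the
  embedding, so carrying coordinates from one splitting to another is an isometry.\<close>

lemma transport_isometry:
  assumes X: "split_space A star V h V' h' u x \<xi>" and g: "g \<in> isometries A V' h' V' h'"
  defines "T \<equiv> \<lambda>v\<in>carrier V. case coordinates v of (a, b, z) \<Rightarrow> split_space.assemble V u x \<xi> a b (g z)"
  shows "T \<in> isometries A V h V h" "T u = u" "T w = x" "z \<in> carrier V' \<Longrightarrow> T (\<psi> z) = \<xi> (g z)"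
proof -
  interpret X: split_space A star V h V' h' u x \<xi> by (rule X)
  note gD = isometriesD[OF g]
  have g0: "g \<zero>\<^bsub>V'\<^esub> = \<zero>\<^bsub>V'\<^esub>" using gD(3)[of \<zero> "\<zero>\<^bsub>V'\<^esub>"] gD(1) by simp
  have T: "T (assemble a b z) = X.assemble a b (g z)"
    if "a \<in> carrier A" "b \<in> carrier A" "z \<in> carrier V'" for a b z
    using that coordinates_assemble assemble_closed by (simp add: T_def)
  show "T \<in> isometries A V h V h"
  proof (rule isometriesI)
    fix v assume "v \<in> carrier V"
    then obtain a b z where v: "a \<in> carrier A" "b \<in> carrier A" "z \<in> carrier V'" "v = assemble a b z"
      using assemble_surj by blast
    then show "T v \<in> carrier V" using T X.assemble_closed gD(1) by simp
    show "T (c \<odot>\<^bsub>V\<^esub> v) = c \<odot>\<^bsub>V\<^esub> T v" if "c \<in> carrier A" for c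
      using v that gD(1,3) by (simp add: assemble_smult X.assemble_smult T)
    fix v' assume "v' \<in> carrier V"
    then obtain a' b' z' where v': "a' \<in> carrier A" "b' \<in> carrier A" "z' \<in> carrier V'" "v' = assemble a' b' z'"
      using assemble_surj by blast
    show "T (v \<oplus>\<^bsub>V\<^esub> v') = T v \<oplus>\<^bsub>V\<^esub> T v'"
      using v v' gD(1,2) by (simp add: assemble_add X.assemble_add T)
    show "h (T v) (T v') = h v v'"
      using v v' gD(1,4) by (simp add: h_assemble_assemble X.h_assemble_assemble T)
  qed
  show "T u = u" "T w = x"
    using T[of \<one> \<zero> "\<zero>\<^bsub>V'\<^esub>"] T[of \<zero> \<one> "\<zero>\<^bsub>V'\<^esub>"] g0
    by (simp_all add: assemble_u assemble_w X.assemble_u X.assemble_w)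
  show "T (\<psi> z) = \<xi> (g z)" if "z \<in> carrier V'"
    using that T[of \<zero> \<zero> z] gD(1) by (simp add: assemble_\<psi> X.assemble_\<psi>)
qed

text \<open>An isometry that fixes \<open>u\<close> and sends \<open>w\<close> to \<open>x\<close> carries one complement to the other, and
  hence acts on \<open>V'\<close>.\<close>

lemma induced_isometry:
  assumes X: "split_space A star V h V' h' u x \<xi>"
    and f: "f \<in> isometries A V h V h" "f u = u" "f w = x"
  shows "\<exists>g\<in>isometries A V' h' V' h' \<inter> extensional (carrier V'). \<forall>z\<in>carrier V'. \<xi> (g z) = f (\<psi> z)"
proof -
  interpret X: split_space A star V h V' h' u x \<xi> by (rule X)
  note fD = isometriesD[OF f(1)] and \<psi>D = isometriesD[OF \<psi>] and \<xi>D = isometriesD[OF X.\<psi>]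
  define g where "g = (\<lambda>z\<in>carrier V'. inv_into (carrier V') \<xi> (f (\<psi> z)))"
  have im: "f (\<psi> z) \<in> \<xi> ` carrier V'" if "z \<in> carrier V'" for z
  proof -
    have "h u (f (\<psi> z)) = \<zero>" "h x (f (\<psi> z)) = \<zero>"
      using fD(4)[OF u \<psi>_perp(1)[OF that]] fD(4)[OF w \<psi>_perp(1)[OF that]] f(2,3) \<psi>_perp[OF that] by simp_all
    then show ?thesis using X.\<psi>_image fD(1) \<psi>_perp(1)[OF that] by blast
  qed
  have g: "\<xi> (g z) = f (\<psi> z)" "g z \<in> carrier V'" if "z \<in> carrier V'" for z
    using that f_inv_into_f[OF im[OF that]] inv_into_into[OF im[OF that]] by (simp_all add: g_def)
  have "g \<in> isometries A V' h' V' h'"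
  proof (rule isometriesI)
    fix z assume z: "z \<in> carrier V'"
    show "g z \<in> carrier V'" by (rule g(2)[OF z])
    show "g (c \<odot>\<^bsub>V'\<^esub> z) = c \<odot>\<^bsub>V'\<^esub> g z" if c: "c \<in> carrier A" for c
      using z c g \<psi>_perp(1) by (intro X.\<psi>_inj) (simp_all add: \<xi>D fD \<psi>D)
    fix y assume y: "y \<in> carrier V'"
    show "g (z \<oplus>\<^bsub>V'\<^esub> y) = g z \<oplus>\<^bsub>V'\<^esub> g y"
      using z y g \<psi>_perp(1) by (intro X.\<psi>_inj) (simp_all add: \<xi>D fD \<psi>D)
    show "h' (g z) (g y) = h' z y"
      using \<xi>D(4)[OF g(2)[OF z] g(2)[OF y]] g z y \<psi>_perp(1) fD(4) \<psi>D(4) by simp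
  qed
  moreover have "g \<in> extensional (carrier V')" by (simp add: g_def)
  ultimately show ?thesis using g(1) by blast
qed

text \<open>An isometry fixing \<open>u\<close> is given by the image of \<open>w\<close> together with an isometry of the
  complement.\<close>

lemma card_stabilizer:
  assumes split: "\<And>x. x \<in> carrier V \<Longrightarrow> h u x = \<one> \<Longrightarrow> h x x = \<zero> \<Longrightarrow>
      \<exists>\<psi>\<in>isometries A V' h' V h. \<psi> ` carrier V' = perp u x"
  shows "card (stabilizer (unitary_group A V h) (\<lambda>g. g) u) =
    card {x \<in> carrier V. h u x = \<one> \<and> h x x = \<zero>} * card (carrier (unitary_group A V' h'))"
proof -
  define \<Omega> where "\<Omega> = {x \<in> carrier V. h u x = \<one> \<and> h x x = \<zero>}"
  let ?U' = "carrier (unitary_group A V' h')"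
  let ?S = "stabilizer (unitary_group A V h) (\<lambda>g. g) u"
  \<comment> \<open>\<open>\<Psi> x\<close> is a chosen identification of \<open>V'\<close> with the complement of \<open>u\<close> and \<open>x\<close>; for \<open>x = w\<close> it need
    not be \<open>\<psi>\<close>.\<close>
  define \<Psi> where "\<Psi> x = (SOME \<psi>. \<psi> \<in> isometries A V' h' V h \<and> \<psi> ` carrier V' = perp u x)" for x
  have \<Psi>: "\<Psi> x \<in> isometries A V' h' V h \<and> \<Psi> x ` carrier V' = perp u x" if "x \<in> \<Omega>" for x
  proof -
    have "\<exists>\<psi>. \<psi> \<in> isometries A V' h' V h \<and> \<psi> ` carrier V' = perp u x"
      using split[of x] that by (auto simp: \<Omega>_def)
    then show ?thesis unfolding \<Psi>_def by (rule someI_ex)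
  qed
  have X: "split_space A star V h V' h' u x (\<Psi> x)" if "x \<in> \<Omega>" for x
  proof -
    have "split_space_axioms A V h V' h' u x (\<Psi> x)"
      using \<Psi>[OF that] that u by unfold_locales (simp_all add: \<Omega>_def)
    then show ?thesis
      by (intro split_space.intro hermitian_space_axioms S.hermitian_space_axioms)
  qed
  define T where "T = (\<lambda>(x, g). \<lambda>v\<in>carrier V. case coordinates v of (a, b, z) \<Rightarrow>
    split_space.assemble V u x (\<Psi> x) a b (g z))"
  have U': "g \<in> isometries A V' h' V' h'" "g \<in> extensional (carrier V')" if "g \<in> ?U'" for g
    using that S.carrier_unitary_group by auto
  have T: "T (x, g) \<in> isometries A V h V h" "T (x, g) u = u" "T (x, g) w = x"
      "z \<in> carrier V' \<Longrightarrow> T (x, g) (\<psi> z) = \<Psi> x (g z)" "T (x, g) \<in> extensional (carrier V)"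
    if "x \<in> \<Omega>" "g \<in> ?U'" for x g z
    using transport_isometry[OF X[OF that(1)] U'(1)[OF that(2)]] by (simp_all add: T_def)
  have "bij_betw T (\<Omega> \<times> ?U') ?S"
  proof (rule bij_betw_imageI)
    show "inj_on T (\<Omega> \<times> ?U')"
    proof (rule inj_onI, clarify)
      fix x g x' g' assume x: "x \<in> \<Omega>" "x' \<in> \<Omega>" and g: "g \<in> ?U'" "g' \<in> ?U'"
        and eq: "T (x, g) = T (x', g')"
      have xx: "x = x'" using T(3)[OF x(1) g(1)] T(3)[OF x(2) g(2)] eq by simp
      have "g = g'"
      proof (rule extensionalityI[OF U'(2)[OF g(1)] U'(2)[OF g(2)]])
        fix z assume z: "z \<in> carrier V'"
        have "\<Psi> x (g z) = \<Psi> x (g' z)"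
          using T(4)[OF x(1) g(1) z] T(4)[OF x(2) g(2) z] eq xx by simp
        then show "g z = g' z"
          using split_space.\<psi>_inj[OF X[OF x(1)]] isometriesD(1)[OF U'(1)[OF g(1)] z]
            isometriesD(1)[OF U'(1)[OF g(2)] z] by simp
      qed
      with xx show "x = x' \<and> g = g'" by simp
    qed
    show "T ` (\<Omega> \<times> ?U') = ?S"
    proof (intro equalityI subsetI)
      fix f assume "f \<in> T ` (\<Omega> \<times> ?U')"
      then obtain x g where "x \<in> \<Omega>" "g \<in> ?U'" "f = T (x, g)" by blast
      then show "f \<in> ?S" using T(1,2,5) by (simp add: stabilizer_def carrier_unitary_group)
    next
      fix f assume "f \<in> ?S"
      then have f: "f \<in> isometries A V h V h" "f \<in> extensional (carrier V)" "f u = u"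
        by (simp_all add: stabilizer_def carrier_unitary_group)
      have x: "f w \<in> \<Omega>"
        using isometriesD(1)[OF f(1) w] isometriesD(4)[OF f(1) u w] isometriesD(4)[OF f(1) w w]
          f(3) huw hww by (simp add: \<Omega>_def)
      then obtain g where g: "g \<in> ?U'" "\<And>z. z \<in> carrier V' \<Longrightarrow> \<Psi> (f w) (g z) = f (\<psi> z)"
        using induced_isometry[OF X[OF x] f(1,3) refl] S.carrier_unitary_group by blast
      have "f = T (f w, g)"
        using f(3) T[OF x g(1)] g(2) by (intro isometry_extensional_eqI f(1,2)) simp_all
      then show "f \<in> T ` (\<Omega> \<times> ?U')" using x g(1) by blast
    qed
  qed
  then show ?thesis
    using bij_betw_same_card[of T "\<Omega> \<times> ?U'" ?S] by (simp add: card_cartesian_product \<Omega>_def)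
qed

end

theorem theorem7p3:
  fixes A :: "('a, 'r) ring_scheme" and star :: "'a \<Rightarrow> 'a" and \<epsilon> :: 'a
    and V :: "('a, 'v, 's) module_scheme" and h :: "'v \<Rightarrow> 'v \<Rightarrow> 'a"
    and V' :: "('a, 'w, 't) module_scheme" and h' :: "'w \<Rightarrow> 'w \<Rightarrow> 'a"
    and m :: nat and u :: 'v
  assumes "finite_local_involution_ring A star"
    and "\<epsilon> \<in> Units (fixed_ring A star) - unit_squares (fixed_ring A star)"
    and "m > 2"
    and "free_of_rank A V m" and "nondegenerate_hermitian_form A star V h"
    and "primitive_vector A V u" and "h u u \<notin> Units (fixed_ring A star)"
    and "free_of_rank A V' (m - 2)" and "nondegenerate_hermitian_form A star V' h'"
    and "(kind_I A star m V h \<and> kind_I A star (m - 2) V' h') \<or>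
         (kind_II A star \<epsilon> m V h \<and> kind_II A star \<epsilon> (m - 2) V' h')"
  shows "real (card (stabilizer (unitary_group A V h) (\<lambda>g. g) u)) =
    real (card (carrier (unitary_group A V' h'))) * real (card (carrier A)) ^ (m - 1)
      / real (card (carrier (fixed_ring A star)))"
proof -
  interpret local_star_ring A star
    using assms(1) by (simp add: local_star_ring_def)
  define n where "n = m - 2"
  have m: "m = Suc (Suc n)" "n > 0" using assms(3) by (auto simp: n_def)
  obtain d where d: "form_of_type A star m V h (kind_diagonal A m d)"
      "form_of_type A star n V' h' (kind_diagonal A n d)"
    using assms(10) unfolding kind_I_def kind_II_def n_def by blast
  obtain b where b: "is_basis A V (Suc (Suc n)) b"
      and gram: "\<And>i j. i < Suc (Suc n) \<Longrightarrow> j < Suc (Suc n) \<Longrightarrow>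
        h (b i) (b j) = (if i = j then kind_diagonal A m d i else \<zero>\<^bsub>A\<^esub>)"
    using d(1) unfolding form_of_type_def m(1) by blast
  obtain b' where b': "is_basis A V' n b'"
      and gram': "\<And>i j. i < n \<Longrightarrow> j < n \<Longrightarrow>
        h' (b' i) (b' j) = (if i = j then kind_diagonal A n d i else \<zero>\<^bsub>A\<^esub>)"
    using d(2) unfolding form_of_type_def by blast
  have units: "\<And>i. i < Suc (Suc n) \<Longrightarrow> kind_diagonal A m d i \<in> Units A"
    using d(1) fixed_Units unfolding form_of_type_def m(1) by blast
  have shift: "kind_diagonal A m d (Suc (Suc i)) = kind_diagonal A n d i" for i
    by (simp add: kind_diagonal_def m(1))
  have lengths: "kind_diagonal A m d 0 = \<one>\<^bsub>A\<^esub>" "kind_diagonal A m d 1 = \<ominus>\<^bsub>A\<^esub> \<one>\<^bsub>A\<^esub>"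
    using m by (simp_all add: kind_diagonal_def)
  have "right_module A V" "right_module A V'" using assms(4,8) by (simp_all add: free_of_rank_def)
  moreover have "hermitian_form A star V h" "hermitian_form A star V' h'"
    using assms(5,9) by (simp_all add: nondegenerate_hermitian_form_def)
  ultimately have "hermitian_space A star V h" "hermitian_space A star V' h'"
    using right_module.finite_free_module[OF _ b finite_carrier]
      right_module.finite_free_module[OF _ b' finite_carrier] assms(5,9) local_star_ring_axioms
    by (simp_all add: hermitian_space_def hermitian_space_axioms_def)
  then interpret V: hermitian_space A star V h + V': hermitian_space A star V' h' .
  have u: "u \<in> carrier V" using assms(6) by (simp add: primitive_vector_def)
  have r: "h u u \<in> rad" using fixed_nonunit_in_rad[OF V.length_fixed[OF u] assms(7)] .
  obtain w where w: "w \<in> carrier V" "h u w = \<one>\<^bsub>A\<^esub>" "h w w = \<zero>\<^bsub>A\<^esub>"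
    using V.isotropic_partner[OF u r] V.primitive_vector_pairs_to_one[OF b units gram assms(6)] by blast
  have "\<exists>\<phi>\<in>isometries A V' h' V h. \<phi> ` carrier V' = V.perp (b 0) (b 1)"
    using gram' by (intro V.diagonal_embedding[OF V'.hermitian_space_axioms b b' units units gram])
      (simp_all add: shift)
  then obtain \<phi> where \<phi>: "\<phi> \<in> isometries A V' h' V h" "\<phi> ` carrier V' = V.perp (b 0) (b 1)"
    by blast
  have split: "\<exists>\<psi>\<in>isometries A V' h' V h. \<psi> ` carrier V' = V.perp u x"
    if "x \<in> carrier V" "h u x = \<one>\<^bsub>A\<^esub>" "h x x = \<zero>\<^bsub>A\<^esub>" for x
  proof (rule V.hyperbolic_complement[OF _ _ _ _ _ \<phi> u that])
    show "b 0 \<in> carrier V" "b 1 \<in> carrier V" using V.basis_vector[OF b] by simp_all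
    show "h (b 0) (b 0) = \<one>\<^bsub>A\<^esub>" "h (b 1) (b 1) = \<ominus>\<^bsub>A\<^esub> \<one>\<^bsub>A\<^esub>" "h (b 0) (b 1) = \<zero>\<^bsub>A\<^esub>"
      using gram[of 0 0] gram[of 1 1] gram[of 0 1] lengths by simp_all
  qed
  obtain \<psi> where "\<psi> \<in> isometries A V' h' V h" "\<psi> ` carrier V' = V.perp u w"
    using split[OF w] by blast
  then interpret split_space A star V h V' h' u w \<psi>
    using u w by unfold_locales
  have "card (stabilizer (unitary_group A V h) (\<lambda>g. g) u) =
      card {x \<in> carrier V. h u x = \<one>\<^bsub>A\<^esub> \<and> h x x = \<zero>\<^bsub>A\<^esub>} * card (carrier (unitary_group A V' h'))"
    by (rule card_stabilizer) (rule split)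
  then have "card (stabilizer (unitary_group A V h) (\<lambda>g. g) u) * card Fix
      = card (carrier A) ^ n * (card Fix * card Skew) * card (carrier (unitary_group A V' h'))"
    unfolding card_isotropic_partners[OF r] V'.card_free_module[OF b'] by (simp only: ac_simps)
  also have "\<dots> = card (carrier (unitary_group A V' h')) * card (carrier A) ^ (m - 1)"
    by (simp add: card_fixed_mult_card_skew m(1))
  finally have "real (card (stabilizer (unitary_group A V h) (\<lambda>g. g) u)) * real (card Fix)
      = real (card (carrier (unitary_group A V' h'))) * real (card (carrier A)) ^ (m - 1)"
    by (metis of_nat_mult of_nat_power)
  moreover have "card Fix \<noteq> 0"
    using finite_subset[OF Fix_subset finite_carrier] fixed.zero_closed by auto
  ultimately show ?thesis by (simp add: field_simps)
qed

end
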